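(* Let $p>1$, let $0<r<R$, and let $\Omega\subset\mathbb{R}^d$ be a regular domain with boundary decomposition $\partial\Omega=\partial\Omega_D\cup\partial\Omega_N$. Suppose that the origin is exterior to $\Omega$, that $\partial\Omega_N$ is starlike with respect to the origin, and that $\Omega\subset\{\mathbf{x}: r<|\mathbf{x}|<R\}$. a) If the interior of $\Omega$ adjacent to $\partial\Omega_N$ is away from the origin, then $\lambda_1(\Omega,\partial\Omega_D,p)\ge\alpha(r,R,p,d)$. b) If the exterior of $\Omega$ adjacent to $\partial\Omega_N$ is away from the origin, then $\lambda_1(\Omega,\partial\Omega_D,p)\ge\beta(r,R,p,d)$.
   Context: $\Omega$ is a bounded domain in $\mathbb{R}^d$ whose boundary consists of two pieces, $\partial\Omega_D$ and $\partial\Omega_N:=\partial\Omega\setminus\partial\Omega_D$, each of positive $(d-1)$-dimensional surface measure. $\Omega$ is called regular if its boundary is of class $C$ (locally, in suitable Cartesian coordinates, $\partial\Omega$ is the graph of a continuous function with $\Omega$ lying on one side of it) and is $C^1$ a.e. with respect to surface measure. The outward unit normal $\nu$ exists a.e. on $\partial\Omega_N$. Standing assumption: the boundary is sufficiently regular that Green's formula (the Gauss–Green/divergence theorem) is valid on $\Omega$ for the test functions considered. Test functions: $\mathcal{D}(\Omega,\partial\Omega_D)$ is the set of restrictions to $\Omega$ of (real-valued) functions in $C_c^\infty(\mathbb{R}^d\setminus\partial\Omega_D)$; no boundary condition is imposed on $\partial\Omega_N$. The fundamental eigenvalue of the $p$-Laplacian with respect to $\Omega,\partial\Omega_D$ is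 $$\lambda_1(\Omega,\partial\Omega_D,p):=\inf\left\{\frac{\int_\Omega|\nabla\zeta|^p\,dx}{\int_\Omega|\zeta|^p\,dx}:\ \zeta\in\mathcal{D}(\Omega,\partial\Omega_D),\ \zeta\not\equiv 0\right\}.$$ Geometric hypotheses: the origin is exterior to $\Omega$ means $0\notin\overline\Omega$. $\partial\Omega_N$ is starlike with respect to the origin if rays from the origin meet it at most once. "The interior of $\Omega$ adjacent to $\partial\Omega_N$ is away from the origin" means that $\Omega$ lies on the side of $\partial\Omega_N$ facing away from the origin, so that $\nu\cdot\mathbf{x}\le 0$ a.e. on $\partial\Omega_N$; "the exterior of $\Omega$ adjacent to $\partial\Omega_N$ is away from the origin" means that $\Omega$ lies on the side facing the origin, so that $\nu\cdot\mathbf{x}\ge 0$ a.e. on $\partial\Omega_N$. Annulus eigenvalues: let $\mathcal{A}=\{\mathbf{x}\in\mathbb{R}^d: r<|\mathbf{x}|<R\}$. $\alpha(r,R,p,d)$ is the lowest eigenvalue of the $p$-Laplacian on $\mathcal{A}$ with Dirichlet conditions where $|\mathbf{x}|=R$ and Neumann conditions where $|\mathbf{x}|=r$, i.e. $\lambda_1(\mathcal{A},\{|\mathbf{x}|=R\},p)$. $\beta(r,R,p,d)$ is the lowest eigenvalue of the $p$-Laplacian on $\mathcal{A}$ with Neumann conditions where $|\mathbf{x}|=R$ and Dirichlet conditions where $|\mathbf{x}|=r$, i.e. $\lambda_1(\mathcal{A},\{|\mathbf{x}|=r\},p)$. *)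

theory Defs
  imports "HOL-Analysis.Analysis"
begin

section \<open>Hausdorff measure and surface measure\<close>

text \<open>
  The \<open>k\<close>-dimensional Hausdorff measure, normalised so that it agrees with Lebesgue measure on
  \<open>k\<close>-dimensional Euclidean space.  The empty set is singled out because \<open>0 ^ 0 = 1\<close>, and
  boundedness is required because \<^const>\<open>diameter\<close> is meaningless for unbounded sets.
\<close>

definition hausdorff_weight :: "nat \<Rightarrow> 'a::metric_space set \<Rightarrow> ennreal" where
  "hausdorff_weight k C =
     (if C = {} then 0 else ennreal (unit_ball_vol (real k) * (diameter C / 2) ^ k))"

definition hausdorff_pre :: "nat \<Rightarrow> real \<Rightarrow> 'a::metric_space set \<Rightarrow> ennreal" where
  "hausdorff_pre k \<delta> A =
     Inf {(\<Sum>i. hausdorff_weight k (C i)) | C :: nat \<Rightarrow> 'a set.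
            A \<subseteq> (\<Union>i. C i) \<and> (\<forall>i. bounded (C i) \<and> diameter (C i) \<le> \<delta>)}"

definition hausdorff_outer :: "nat \<Rightarrow> 'a::metric_space set \<Rightarrow> ennreal" where
  "hausdorff_outer k A = (SUP \<delta>\<in>{0<..}. hausdorff_pre k \<delta> A)"

definition hausdorff_measure :: "nat \<Rightarrow> 'a::metric_space measure" where
  "hausdorff_measure k =
     measure_of UNIV (lambda_system UNIV UNIV (hausdorff_outer k)) (hausdorff_outer k)"

definition surface_measure :: "(real^'n) measure" where
  "surface_measure = hausdorff_measure (CARD('n) - 1)"

text \<open>
  \<^const>\<open>measure_of\<close> yields the zero measure unless it is given a genuine measure, so we check
  that \<^const>\<open>hausdorff_measure\<close> is not degenerate and that Borel sets are measurable.
\<close>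

lemma hausdorff_pre_empty [simp]: "0 < \<delta> \<Longrightarrow> hausdorff_pre k \<delta> {} = 0"
proof -
  assume "0 < \<delta>"
  then have "hausdorff_pre k \<delta> ({} :: 'a set) \<le> (\<Sum>i::nat. hausdorff_weight k ({} :: 'a set))"
    unfolding hausdorff_pre_def
    by (intro Inf_lower CollectI exI[of _ "\<lambda>_. {}"]) auto
  then show ?thesis by (simp add: hausdorff_weight_def)
qed

lemma hausdorff_outer_empty [simp]: "hausdorff_outer k {} = 0"
  by (simp add: hausdorff_outer_def)

lemma hausdorff_pre_le:
  assumes "A \<subseteq> (\<Union>i. C i)" "\<And>i. bounded (C i)" "\<And>i. diameter (C i) \<le> \<delta>"
  shows "hausdorff_pre k \<delta> A \<le> (\<Sum>i. hausdorff_weight k (C i))"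
  unfolding hausdorff_pre_def using assms by (intro Inf_lower) auto

lemma hausdorff_pre_mono: "A \<subseteq> B \<Longrightarrow> hausdorff_pre k \<delta> A \<le> hausdorff_pre k \<delta> B"
  unfolding hausdorff_pre_def by (intro Inf_superset_mono) auto

lemma hausdorff_pre_antimono:
  "\<delta> \<le> \<epsilon> \<Longrightarrow> hausdorff_pre k \<epsilon> A \<le> hausdorff_pre k \<delta> A"
  unfolding hausdorff_pre_def by (intro Inf_superset_mono) (blast intro: order_trans)

lemma hausdorff_outer_mono: "A \<subseteq> B \<Longrightarrow> hausdorff_outer k A \<le> hausdorff_outer k B"
  unfolding hausdorff_outer_def by (intro SUP_mono) (auto intro: hausdorff_pre_mono)

lemma hausdorff_pre_UN:
  fixes A :: "nat \<Rightarrow> 'a::metric_space set"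
  shows "hausdorff_pre k \<delta> (\<Union>i. A i) \<le> (\<Sum>i. hausdorff_pre k \<delta> (A i))"
proof (rule ennreal_le_epsilon)
  fix e :: real
  assume fin: "(\<Sum>i. hausdorff_pre k \<delta> (A i)) < top" and e: "0 < e"
  have "\<exists>C. A i \<subseteq> (\<Union>j. C j) \<and> (\<forall>j::nat. bounded (C j) \<and> diameter (C j) \<le> \<delta>) \<and>
          (\<Sum>j. hausdorff_weight k (C j)) \<le> hausdorff_pre k \<delta> (A i) + ennreal (e * (1/2) ^ Suc i)"
    for i
  proof -
    have "hausdorff_pre k \<delta> (A i) < top"
      using fin by (metis ennreal_suminf_lessD)
    then have "hausdorff_pre k \<delta> (A i) < hausdorff_pre k \<delta> (A i) + ennreal (e * (1/2) ^ Suc i)"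
      using e by (cases "hausdorff_pre k \<delta> (A i)") (auto simp: ennreal_plus[symmetric] ennreal_less_iff simp del: ennreal_plus)
    then show ?thesis
      unfolding hausdorff_pre_def[of k \<delta> "A i"] Inf_less_iff
      by (auto intro: less_imp_le)
  qed
  then obtain C where C: "\<And>i. A i \<subseteq> (\<Union>j. C i j)"
      "\<And>i j::nat. bounded (C i j)" "\<And>i j. diameter (C i j) \<le> \<delta>"
      "\<And>i. (\<Sum>j. hausdorff_weight k (C i j)) \<le> hausdorff_pre k \<delta> (A i) + ennreal (e * (1/2) ^ Suc i)"
    by metis
  define D where "D n = (case prod_decode n of (i, j) \<Rightarrow> C i j)" for n
  have "hausdorff_pre k \<delta> (\<Union>i. A i) \<le> (\<Sum>n. hausdorff_weight k (D n))"
  proof (rule hausdorff_pre_le)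
    show "(\<Union>i. A i) \<subseteq> (\<Union>n. D n)"
    proof safe
      fix x i assume "x \<in> A i"
      then obtain j where "x \<in> C i j" using C(1)[of i] by blast
      then have "x \<in> D (prod_encode (i, j))" by (simp add: D_def)
      then show "x \<in> (\<Union>n. D n)" by blast
    qed
  qed (auto simp: D_def C split: prod.split)
  also have "\<dots> = (\<Sum>i. \<Sum>j. hausdorff_weight k (C i j))"
    using suminf_ennreal_2dimen[of "\<lambda>i. \<Sum>j. hausdorff_weight k (C i j)"
        "\<lambda>(i, j). hausdorff_weight k (C i j)"]
    by (simp add: D_def split_def)
  also have "\<dots> \<le> (\<Sum>i. hausdorff_pre k \<delta> (A i) + ennreal (e * (1/2) ^ Suc i))"
    by (intro suminf_le C) auto
  also have "\<dots> = (\<Sum>i. hausdorff_pre k \<delta> (A i)) + (\<Sum>i. ennreal (e * (1/2) ^ Suc i))"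
    by (intro suminf_add[symmetric]) auto
  also have "(\<Sum>i. ennreal (e * (1/2) ^ Suc i)) = ennreal e"
    using e sums_mult[OF power_half_series, of e]
    by (intro suminf_ennreal_eq) auto
  finally show "hausdorff_pre k \<delta> (\<Union>i. A i) \<le> (\<Sum>i. hausdorff_pre k \<delta> (A i)) + ennreal e" .
qed

lemma hausdorff_outer_UN:
  "hausdorff_outer k (\<Union>i. A i) \<le> (\<Sum>i. hausdorff_outer k (A (i::nat)))"
  unfolding hausdorff_outer_def[of k "\<Union>i. A i"]
proof (rule SUP_least)
  fix \<delta> :: real assume "\<delta> \<in> {0<..}"
  then have "hausdorff_pre k \<delta> (A i) \<le> hausdorff_outer k (A i)" for i
    unfolding hausdorff_outer_def by (rule SUP_upper)
  then have "(\<Sum>i. hausdorff_pre k \<delta> (A i)) \<le> (\<Sum>i. hausdorff_outer k (A i))"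
    by (intro suminf_le) auto
  with hausdorff_pre_UN show "hausdorff_pre k \<delta> (\<Union>i. A i) \<le> (\<Sum>i. hausdorff_outer k (A i))"
    by (rule order_trans)
qed

lemma outer_measure_space_hausdorff: "outer_measure_space UNIV (hausdorff_outer k)"
  by (auto simp: outer_measure_space_def positive_def increasing_def countably_subadditive_def
      intro: hausdorff_outer_mono hausdorff_outer_UN)

lemma measure_space_hausdorff:
  "measure_space UNIV (lambda_system UNIV UNIV (hausdorff_outer k)) (hausdorff_outer k)"
  using sigma_algebra.caratheodory_lemma[OF sigma_algebra_Pow outer_measure_space_hausdorff[of k, folded Pow_UNIV]]
  by simp

lemma sets_hausdorff_measure:
  "sets (hausdorff_measure k) = lambda_system UNIV UNIV (hausdorff_outer k)"
  unfolding hausdorff_measure_def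
  using measure_space_hausdorff[of k]
  by (metis measure_space_def sigma_algebra.sets_measure_of_eq)

lemma emeasure_hausdorff_measure:
  assumes "A \<in> sets (hausdorff_measure k)"
  shows "emeasure (hausdorff_measure k) A = hausdorff_outer k A"
  using measure_space_hausdorff[of k] assms[unfolded sets_hausdorff_measure]
  unfolding hausdorff_measure_def
  by (intro emeasure_measure_of_sigma) (auto simp: measure_space_def)

lemma hausdorff_outer_Un: "hausdorff_outer k (A \<union> B) \<le> hausdorff_outer k A + hausdorff_outer k B"
proof -
  have "A \<union> B = (\<Union>i. binaryset A B i)" by (simp add: UN_binaryset_eq)
  then have "hausdorff_outer k (A \<union> B) \<le> (\<Sum>i. hausdorff_outer k (binaryset A B i))"
    using hausdorff_outer_UN[of k "binaryset A B"] by simp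
  also have "\<dots> = hausdorff_outer k A + hausdorff_outer k B"
    by (rule suminf_binaryset_eq) simp
  finally show ?thesis .
qed

lemma hausdorff_outer_separated:
  fixes A B :: "'a::metric_space set"
  assumes "0 < d" and sep: "\<And>x y. x \<in> A \<Longrightarrow> y \<in> B \<Longrightarrow> d \<le> dist x y"
  shows "hausdorff_outer k (A \<union> B) = hausdorff_outer k A + hausdorff_outer k B"
proof (rule antisym[OF hausdorff_outer_Un])
  have pre: "hausdorff_pre k \<delta> A + hausdorff_pre k \<delta> B \<le> hausdorff_pre k \<delta> (A \<union> B)"
    if "0 < \<delta>" "\<delta> < d" for \<delta>
    unfolding hausdorff_pre_def[of k \<delta> "A \<union> B"]
  proof (rule Inf_greatest, clarify)
    fix C :: "nat \<Rightarrow> 'a set"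
    assume C: "A \<union> B \<subseteq> (\<Union>i. C i)" "\<forall>i. bounded (C i) \<and> diameter (C i) \<le> \<delta>"
    define CA where "CA i = (if C i \<inter> A \<noteq> {} then C i else {})" for i
    define CB where "CB i = (if C i \<inter> A = {} then C i else {})" for i
    have disj: "C i \<inter> B = {}" if meets: "C i \<inter> A \<noteq> {}" for i
    proof (rule ccontr)
      assume "C i \<inter> B \<noteq> {}"
      with meets obtain x y where "x \<in> C i" "x \<in> A" "y \<in> C i" "y \<in> B" by blast
      then have "d \<le> diameter (C i)"
        using sep[of x y] diameter_bounded_bound[of "C i" x y] C(2) by fastforce
      with C(2) \<open>\<delta> < d\<close> show False by (meson leD order_trans)
    qed
    have "hausdorff_pre k \<delta> A \<le> (\<Sum>i. hausdorff_weight k (CA i))"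
    proof (rule hausdorff_pre_le)
      show "A \<subseteq> (\<Union>i. CA i)"
      proof
        fix x assume "x \<in> A"
        with C(1) obtain i where "x \<in> C i" by blast
        with \<open>x \<in> A\<close> have "x \<in> CA i" by (auto simp: CA_def)
        then show "x \<in> (\<Union>i. CA i)" by blast
      qed
    qed (use C that in \<open>auto simp: CA_def\<close>)
    moreover have "hausdorff_pre k \<delta> B \<le> (\<Sum>i. hausdorff_weight k (CB i))"
    proof (rule hausdorff_pre_le)
      show "B \<subseteq> (\<Union>i. CB i)"
      proof
        fix x assume "x \<in> B"
        with C(1) obtain i where "x \<in> C i" by blast
        with disj[of i] \<open>x \<in> B\<close> have "x \<in> CB i" by (auto simp: CB_def)
        then show "x \<in> (\<Union>i. CB i)" by blast
      qed
    qed (use C that in \<open>auto simp: CB_def\<close>)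
    ultimately have "hausdorff_pre k \<delta> A + hausdorff_pre k \<delta> B \<le>
        (\<Sum>i. hausdorff_weight k (CA i)) + (\<Sum>i. hausdorff_weight k (CB i))"
      by (rule add_mono)
    also have "\<dots> = (\<Sum>i. hausdorff_weight k (CA i) + hausdorff_weight k (CB i))"
      by (intro suminf_add) auto
    also have "\<dots> = (\<Sum>i. hausdorff_weight k (C i))"
      by (intro suminf_cong) (auto simp: CA_def CB_def hausdorff_weight_def)
    finally show "hausdorff_pre k \<delta> A + hausdorff_pre k \<delta> B \<le> (\<Sum>i. hausdorff_weight k (C i))" .
  qed
  have "hausdorff_pre k \<delta> A + hausdorff_pre k \<epsilon> B \<le> hausdorff_outer k (A \<union> B)"
    if "0 < \<delta>" "0 < \<epsilon>" for \<delta> \<epsilon>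
  proof -
    define \<eta> where "\<eta> = Min {\<delta>, \<epsilon>, d / 2}"
    have \<eta>: "0 < \<eta>" "\<eta> \<le> \<delta>" "\<eta> \<le> \<epsilon>" "\<eta> < d" using that \<open>0 < d\<close> by (auto simp: \<eta>_def min_def)
    have "hausdorff_pre k \<delta> A + hausdorff_pre k \<epsilon> B \<le> hausdorff_pre k \<eta> A + hausdorff_pre k \<eta> B"
      using \<eta> by (intro add_mono hausdorff_pre_antimono)
    also have "\<dots> \<le> hausdorff_pre k \<eta> (A \<union> B)" by (rule pre) (use \<eta> in auto)
    also have "\<dots> \<le> hausdorff_outer k (A \<union> B)"
      unfolding hausdorff_outer_def using \<eta> by (intro SUP_upper) auto
    finally show ?thesis .
  qed
  then have *: "hausdorff_outer k A + hausdorff_pre k \<epsilon> B \<le> hausdorff_outer k (A \<union> B)" if "0 < \<epsilon>" for \<epsilon>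
    unfolding hausdorff_outer_def[of k A] using that
    by (subst ennreal_SUP_add_left[symmetric]) (auto intro!: SUP_least)
  have "hausdorff_outer k A + hausdorff_outer k B =
      (SUP \<epsilon>\<in>{0<..}. hausdorff_outer k A + hausdorff_pre k \<epsilon> B)"
    unfolding hausdorff_outer_def[of k B] by (subst ennreal_SUP_add_right) auto
  also have "\<dots> \<le> hausdorff_outer k (A \<union> B)" using * by (auto intro!: SUP_least)
  finally show "hausdorff_outer k A + hausdorff_outer k B \<le> hausdorff_outer k (A \<union> B)" .
qed

lemma hausdorff_outer_separated_family:
  fixes T :: "nat \<Rightarrow> 'a::metric_space set"
  assumes sep: "\<And>N. \<exists>d>0. \<forall>j<N. \<forall>x\<in>T j. \<forall>y\<in>T N. d \<le> dist x y"
    and sub: "\<And>j. T j \<subseteq> E"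
  shows "(\<Sum>j. hausdorff_outer k (T j)) \<le> hausdorff_outer k E"
proof (rule suminf_le_const)
  fix N
  have "(\<Sum>j<N. hausdorff_outer k (T j)) = hausdorff_outer k (\<Union>j<N. T j)"
  proof (induction N)
    case (Suc N)
    obtain d where d: "d > 0" "\<forall>j<N. \<forall>x\<in>T j. \<forall>y\<in>T N. d \<le> dist x y" using sep by blast
    have "hausdorff_outer k ((\<Union>j<N. T j) \<union> T N) = hausdorff_outer k (\<Union>j<N. T j) + hausdorff_outer k (T N)"
      using d by (intro hausdorff_outer_separated[of d]) auto
    with Suc show ?case by (simp add: lessThan_Suc Un_commute add.commute)
  qed simp
  also have "\<dots> \<le> hausdorff_outer k E" using sub by (intro hausdorff_outer_mono) auto
  finally show "(\<Sum>j<N. hausdorff_outer k (T j)) \<le> hausdorff_outer k E" .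
qed simp

lemma closed_in_hausdorff_measure:
  fixes F :: "'a::metric_space set"
  assumes "closed F"
  shows "F \<in> sets (hausdorff_measure k)"
proof (cases "F = {}")
  case False
  have "hausdorff_outer k (F \<inter> E) + hausdorff_outer k (E - F) \<le> hausdorff_outer k E" for E
  proof (cases "hausdorff_outer k E = top")
    case False
    define A where "A n = {y \<in> E. 1 / real (n + 1) < infdist y F}" for n :: nat
    define S where "S m = {y \<in> E. 1 / real (m + 2) < infdist y F \<and> infdist y F \<le> 1 / real (m + 1)}" for m :: nat
    have lip: "infdist x F \<le> infdist y F + dist x y" for x y
      by (rule infdist_triangle)
    have gap: "\<exists>d>0. \<forall>i<N. \<forall>x\<in>S (2 * i + c). \<forall>y\<in>S (2 * N + c). d \<le> dist x y" for N c
    proof (intro exI conjI allI impI ballI)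
      let ?d = "1 / real (2 * N + c) - 1 / real (2 * N + c + 1)"
      show "0 < (if N = 0 then 1 else ?d)" by (auto intro!: divide_strict_left_mono)
      fix i x y assume i: "i < N" and x: "x \<in> S (2 * i + c)" and y: "y \<in> S (2 * N + c)"
      have "1 / real (2 * N + c) \<le> 1 / real (2 * i + c + 2)"
        using i by (intro divide_left_mono) auto
      then show "(if N = 0 then 1 else ?d) \<le> dist x y"
        using i x y lip[of x y] by (auto simp: S_def algebra_simps)
    qed
    have sumc: "(\<Sum>j. hausdorff_outer k (S (2 * j + c))) \<le> hausdorff_outer k E" for c
      by (rule hausdorff_outer_separated_family[OF gap]) (auto simp: S_def)
    let ?h = "\<lambda>m. hausdorff_outer k (S m)"
    have "(\<Sum>m<N. ?h m) \<le> (\<Sum>j<N. ?h (2 * j + 0)) + (\<Sum>j<N. ?h (2 * j + 1))" for N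
    proof -
      have "(\<Sum>m<2 * N. ?h m) = (\<Sum>j<N. ?h (2 * j + 0)) + (\<Sum>j<N. ?h (2 * j + 1))"
        by (induction N) (auto simp: algebra_simps)
      moreover have "(\<Sum>m<N. ?h m) \<le> (\<Sum>m<2 * N. ?h m)" by (intro sum_mono2) auto
      ultimately show ?thesis by simp
    qed
    also have "\<dots> N \<le> (\<Sum>j. ?h (2 * j + 0)) + (\<Sum>j. ?h (2 * j + 1))" for N
      by (intro add_mono sum_le_suminf) auto
    also have "\<dots> \<le> hausdorff_outer k E + hausdorff_outer k E"
      by (intro add_mono sumc)
    finally have "(\<Sum>m. ?h m) \<le> hausdorff_outer k E + hausdorff_outer k E"
      by (intro suminf_le_const) auto
    also have "\<dots> < top" using False by (simp add: less_top[symmetric])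
    finally have fin: "(\<Sum>m. ?h m) < top" .
    define t where "t n = (\<Sum>m. ?h (m + n))" for n
    have "t \<longlonglongrightarrow> 0"
    proof -
      have fm: "?h m < top" for m using fin by (metis ennreal_suminf_lessD)
      define r where "r m = enn2real (?h m)" for m
      have r: "?h m = ennreal (r m)" for m using fm by (simp add: r_def)
      have r0: "r m \<ge> 0" for m by (simp add: r_def)
      have sr: "summable r"
        using fin r0 unfolding r by (intro summable_suminf_not_top) auto
      have "(\<lambda>n. \<Sum>m. r (m + n)) \<longlonglongrightarrow> 0"
        using suminf_exist_split2[OF sr] .
      then have "(\<lambda>n. ennreal (\<Sum>m. r (m + n))) \<longlonglongrightarrow> ennreal 0"
        by (intro tendsto_ennrealI)
      moreover have "t n = ennreal (\<Sum>m. r (m + n))" for n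
        unfolding t_def r using sr r0 by (intro suminf_ennreal2) (auto simp: summable_iff_shift)
      ultimately show ?thesis by (simp add: tendsto_cong[of t "\<lambda>n. ennreal (\<Sum>m. r (m + n))"])
    qed
    have bound: "hausdorff_outer k (F \<inter> E) + hausdorff_outer k (E - F) \<le> hausdorff_outer k E + t n" for n
    proof -
      have cov: "E - F \<subseteq> A n \<union> (\<Union>m. S (m + n))"
      proof
        fix y assume y: "y \<in> E - F"
        then have pos: "0 < infdist y F"
          using assms \<open>F \<noteq> {}\<close> by (metis DiffD2 in_closed_iff_infdist_zero infdist_nonneg less_le)
        show "y \<in> A n \<union> (\<Union>m. S (m + n))"
        proof (rule ccontr)
          assume neg: "y \<notin> A n \<union> (\<Union>m. S (m + n))"
          have "infdist y F \<le> 1 / real (m + n + 1)" for m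
          proof (induction m)
            case 0 then show ?case using neg y by (auto simp: A_def)
          next
            case (Suc m)
            have "y \<notin> S (m + n)" using neg by blast
            with Suc y show ?case by (auto simp: S_def)
          qed
          moreover obtain m where "inverse (real (Suc m)) < infdist y F"
            using pos reals_Archimedean by blast
          moreover have "1 / real (m + n + 1) \<le> inverse (real (Suc m))"
            by (simp add: field_simps)
          ultimately show False by (meson leD order_le_less_trans order_trans)
        qed
      qed
      have "hausdorff_outer k (E - F) \<le> hausdorff_outer k (A n \<union> (\<Union>m. S (m + n)))"
        by (rule hausdorff_outer_mono[OF cov])
      also have "\<dots> \<le> hausdorff_outer k (A n) + hausdorff_outer k (\<Union>m. S (m + n))"
        by (rule hausdorff_outer_Un)
      also have "\<dots> \<le> hausdorff_outer k (A n) + t n"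
        unfolding t_def by (intro add_left_mono hausdorff_outer_UN)
      finally have "hausdorff_outer k (F \<inter> E) + hausdorff_outer k (E - F)
          \<le> (hausdorff_outer k (F \<inter> E) + hausdorff_outer k (A n)) + t n"
        by (simp add: add.assoc add_left_mono)
      also have "hausdorff_outer k (F \<inter> E) + hausdorff_outer k (A n) = hausdorff_outer k ((F \<inter> E) \<union> A n)"
      proof (rule hausdorff_outer_separated[symmetric])
        show "0 < 1 / real (n + 1)" by simp
        fix x y assume "x \<in> F \<inter> E" "y \<in> A n"
        then show "1 / real (n + 1) \<le> dist x y"
          using infdist_le[of x F y] by (simp add: A_def dist_commute)
      qed
      also have "\<dots> \<le> hausdorff_outer k E" by (rule hausdorff_outer_mono) (auto simp: A_def)
      finally show ?thesis by (simp add: add_right_mono)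
    qed
    have "(\<lambda>n. hausdorff_outer k E + t n) \<longlonglongrightarrow> hausdorff_outer k E + 0"
      using \<open>t \<longlonglongrightarrow> 0\<close> by (intro tendsto_add tendsto_const)
    then show ?thesis using bound by (intro LIMSEQ_le_const) auto
  qed simp
  moreover have "hausdorff_outer k E \<le> hausdorff_outer k (F \<inter> E) + hausdorff_outer k (E - F)" for E
    using hausdorff_outer_Un[of k "F \<inter> E" "E - F"] by (simp add: Int_commute Un_Diff_Int Un_commute)
  moreover have "(UNIV - F) \<inter> E = E - F" for E by blast
  ultimately show ?thesis
    unfolding sets_hausdorff_measure lambda_system_def by (auto intro: antisym)
qed (simp add: sets_hausdorff_measure lambda_system_def)

lemma space_hausdorff_measure [simp]: "space (hausdorff_measure k) = UNIV"
  by (simp add: hausdorff_measure_def space_measure_of_conv)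

lemma sets_borel_subset_hausdorff_measure: "sets borel \<subseteq> sets (hausdorff_measure k)"
proof -
  have "sigma_sets UNIV (Collect closed) \<subseteq> sets (hausdorff_measure k :: 'a measure)"
    using sets.sigma_sets_subset[of "Collect closed" "hausdorff_measure k :: 'a measure"]
    by (auto intro: closed_in_hausdorff_measure)
  then show ?thesis by (simp add: borel_eq_closed)
qed


section \<open>Gradient, divergence and test functions\<close>

definition grad :: "('a::real_inner \<Rightarrow> real) \<Rightarrow> 'a \<Rightarrow> 'a" where
  "grad f x = (THE D. GDERIV f x :> D)"

definition divergence :: "(real^'n \<Rightarrow> real^'n) \<Rightarrow> real^'n \<Rightarrow> real" where
  "divergence F x = (\<Sum>i\<in>UNIV. frechet_derivative F (at x) (axis i 1) $ i)"

text \<open>\<open>k\<close> times continuously differentiable on the whole space, via directional derivatives.\<close>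

fun C_k :: "nat \<Rightarrow> ('a::real_normed_vector \<Rightarrow> 'b::real_normed_vector) \<Rightarrow> bool" where
  "C_k 0 f \<longleftrightarrow> continuous_on UNIV f"
| "C_k (Suc k) f \<longleftrightarrow>
     (\<forall>x. f differentiable at x) \<and> (\<forall>v. C_k k (\<lambda>x. frechet_derivative f (at x) v))"

definition support :: "('a::topological_space \<Rightarrow> 'b::zero) \<Rightarrow> 'a set" where
  "support f = closure {x. f x \<noteq> 0}"

text \<open>
  A function in \<open>C\<^sub>c\<^sup>\<infinity>(\<real>\<^sup>d - D)\<close> is identified with its extension by zero.  The restriction to
  \<open>\<Omega>\<close> is not performed on the functions themselves; instead every notion below looks at a test
  function on \<open>\<Omega>\<close> only.
\<close>

definition test_functions :: "(real^'n) set \<Rightarrow> (real^'n \<Rightarrow> real) set" where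
  "test_functions D = {\<zeta>. (\<forall>k. C_k k \<zeta>) \<and> compact (support \<zeta>) \<and> support \<zeta> \<inter> D = {}}"

definition fundamental_eigenvalue :: "(real^'n) set \<Rightarrow> (real^'n) set \<Rightarrow> real \<Rightarrow> real" where
  "fundamental_eigenvalue \<Omega> D p =
     Inf {(LINT x:\<Omega>|lborel. norm (grad \<zeta> x) powr p) / (LINT x:\<Omega>|lborel. \<bar>\<zeta> x\<bar> powr p) | \<zeta>.
            \<zeta> \<in> test_functions D \<and> (\<exists>x\<in>\<Omega>. \<zeta> x \<noteq> 0)}"


section \<open>Regular domains\<close>

definition bounded_domain :: "(real^'n) set \<Rightarrow> bool" where
  "bounded_domain \<Omega> \<longleftrightarrow> open \<Omega> \<and> connected \<Omega> \<and> \<Omega> \<noteq> {} \<and> bounded \<Omega>"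

text \<open>
  Near \<open>x\<close>, in Cartesian coordinates whose last axis is the unit vector \<open>e\<close>, the boundary is the
  graph of the \<open>C\<^sup>k\<close> function \<open>g\<close> and \<open>\<Omega>\<close> lies strictly below it.  A function of the first
  \<open>d - 1\<close> coordinates is the same as a function on the whole space that is invariant under
  translation along \<open>e\<close>.
\<close>

definition graph_chart ::
    "nat \<Rightarrow> (real^'n) set \<Rightarrow> real^'n \<Rightarrow> real^'n \<Rightarrow> (real^'n \<Rightarrow> real) \<Rightarrow> bool" where
  "graph_chart k \<Omega> x e g \<longleftrightarrow>
     norm e = 1 \<and> C_k k g \<and> (\<forall>y t. g (y + t *\<^sub>R e) = g y) \<and>
     (\<exists>U. open U \<and> x \<in> U \<and>
          \<Omega> \<inter> U = {y \<in> U. y \<bullet> e < g y} \<and>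
          frontier \<Omega> \<inter> U = {y \<in> U. y \<bullet> e = g y})"

definition C_k_boundary_point :: "nat \<Rightarrow> (real^'n) set \<Rightarrow> real^'n \<Rightarrow> bool" where
  "C_k_boundary_point k \<Omega> x \<longleftrightarrow> x \<in> frontier \<Omega> \<and> (\<exists>e g. graph_chart k \<Omega> x e g)"

definition regular_domain :: "(real^'n) set \<Rightarrow> bool" where
  "regular_domain \<Omega> \<longleftrightarrow>
     (\<forall>x \<in> frontier \<Omega>. C_k_boundary_point 0 \<Omega> x) \<and>
     (AE x in surface_measure. x \<in> frontier \<Omega> \<longrightarrow> C_k_boundary_point 1 \<Omega> x)"

text \<open>
  In a \<open>C\<^sup>1\<close> chart, \<open>\<Omega>\<close> is locally \<open>{y. y \<bullet> e - g y < 0}\<close>, so the outward normal is the normalised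
  gradient \<open>e - \<nabla>g\<close> of the defining function.  It depends only on \<open>\<Omega>\<close> and \<open>x\<close>; at the remaining
  (negligible) boundary points it is set to zero.
\<close>

definition outward_normal :: "(real^'n) set \<Rightarrow> real^'n \<Rightarrow> real^'n" where
  "outward_normal \<Omega> x =
     (if C_k_boundary_point 1 \<Omega> x
      then THE n. \<exists>e g. graph_chart 1 \<Omega> x e g \<and> n = sgn (e - grad g x)
      else 0)"

definition boundary_decomposition :: "(real^'n) set \<Rightarrow> (real^'n) set \<Rightarrow> (real^'n) set \<Rightarrow> bool" where
  "boundary_decomposition \<Omega> D N \<longleftrightarrow>
     D \<subseteq> frontier \<Omega> \<and> N = frontier \<Omega> - D \<and>
     D \<in> sets surface_measure \<and>
     emeasure surface_measure D > 0 \<and> emeasure surface_measure N > 0"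

text \<open>
  The Gauss-Green formula for \<open>C\<^sup>1\<close> vector fields which, like the test functions, are compactly
  supported away from \<open>D\<close>.  Integrability is part of the assertion, since the Bochner
  integral of a non-integrable function is zero by convention.
\<close>

definition green_formula :: "(real^'n) set \<Rightarrow> (real^'n) set \<Rightarrow> bool" where
  "green_formula \<Omega> D \<longleftrightarrow>
     (\<forall>F. C_k 1 F \<and> compact (support F) \<and> support F \<inter> D = {} \<longrightarrow>
        set_integrable surface_measure (frontier \<Omega>) (\<lambda>x. F x \<bullet> outward_normal \<Omega> x) \<and>
        (LINT x:\<Omega>|lborel. divergence F x) =
          (LINT x:frontier \<Omega>|surface_measure. F x \<bullet> outward_normal \<Omega> x))"


section \<open>Position relative to the origin\<close>

definition starlike_wrt_origin :: "'a::real_vector set \<Rightarrow> bool" where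
  "starlike_wrt_origin S \<longleftrightarrow>
     (\<forall>v. \<forall>x \<in> S \<inter> {t *\<^sub>R v | t. 0 \<le> t}. \<forall>y \<in> S \<inter> {t *\<^sub>R v | t. 0 \<le> t}. x = y)"

definition interior_away_from_origin :: "(real^'n) set \<Rightarrow> (real^'n) set \<Rightarrow> bool" where
  "interior_away_from_origin \<Omega> N \<longleftrightarrow>
     (AE x in surface_measure. x \<in> N \<longrightarrow> outward_normal \<Omega> x \<bullet> x \<le> 0)"

definition exterior_away_from_origin :: "(real^'n) set \<Rightarrow> (real^'n) set \<Rightarrow> bool" where
  "exterior_away_from_origin \<Omega> N \<longleftrightarrow>
     (AE x in surface_measure. x \<in> N \<longrightarrow> outward_normal \<Omega> x \<bullet> x \<ge> 0)"


section \<open>Annulus eigenvalues\<close>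

definition annulus :: "real \<Rightarrow> real \<Rightarrow> 'a::real_normed_vector set" where
  "annulus r R = {x. r < norm x \<and> norm x < R}"

definition alpha_annulus :: "'n::finite itself \<Rightarrow> real \<Rightarrow> real \<Rightarrow> real \<Rightarrow> real" where
  "alpha_annulus TYPE('n) r R p =
     fundamental_eigenvalue (annulus r R :: (real^'n) set) {x. norm x = R} p"

definition beta_annulus :: "'n::finite itself \<Rightarrow> real \<Rightarrow> real \<Rightarrow> real \<Rightarrow> real" where
  "beta_annulus TYPE('n) r R p =
     fundamental_eigenvalue (annulus r R :: (real^'n) set) {x. norm x = r} p"

end

theory Submission
  imports Defs
begin

text \<open>
  For a radial field \<open>X x = Q(x \<bullet> x) x\<close> with \<open>div X \<ge> \<lambda> + (p - 1) \<bar>X\<bar>\<^sup>p\<^sup>'\<close> on the annulus and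
  \<open>X \<bullet> \<nu> \<le> 0\<close> on the Neumann part, Green's formula for \<open>\<bar>\<zeta>\<bar>\<^sup>p X\<close> and Young's inequality give
  \<open>\<lambda> \<integral>\<bar>\<zeta>\<bar>\<^sup>p \<le> \<integral>\<bar>\<nabla>\<zeta>\<bar>\<^sup>p\<close>.  For every \<open>\<lambda>\<close> below the annulus eigenvalue such a field comes from a
  positive radial solution \<open>\<phi>\<close> of the \<open>p\<close>-Laplace equation, \<open>X = - \<bar>\<nabla>\<phi>\<bar>\<^sup>p\<^sup>-\<^sup>2 \<nabla>\<phi> / \<phi>\<^sup>p\<^sup>-\<^sup>1\<close>.  The solution
  satisfies the Neumann condition but is \<open>1\<close> instead of \<open>0\<close> on the Dirichlet sphere; it is the
  limit of a monotone iteration, which stays bounded because the Rayleigh quotient bound, applied to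
  the iterates, controls their energy.  The radial variable is \<open>s = x \<bullet> x\<close> throughout, so that
  radial functions are smooth at the origin.
\<close>


section \<open>Smooth functions and cut-offs\<close>

text \<open>The eigenfunction of the annulus would be the natural choice for the radial solution,
  but it vanishes on the Dirichlet sphere, where the field would blow up. The boundary value 1 keeps
  the field C^1 up to both spheres. The price is a \<open>lam\<close> strictly below the eigenvalue,
  which an infimum does not notice; this gap is also what closes the energy estimate. In the
  variable s = |x|^2 the equation has two weights. \<open>m0 s = s powr (d / 2 - 1)\<close> is, up
  to a constant, the density of the image of Lebesgue measure under |x|^2; \<open>m1\<close> carries
  the additional factor (2 sqrt s)^p, since the gradient of f(|x|^2) has norm 2 sqrt s |f'|. The
  annulus eigenvalue enters only as the constant of a one-dimensional Hardy inequality with these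
  weights. Test functions vanish near the Dirichlet sphere, whereas the iterates minus 1 vanish only
  on it, so a density argument has to come in between. The solution decreases from the Neumann to
  the Dirichlet sphere, so the field points towards the latter: outwards in case a), inwards in case
  b). This is the direction that the sign of the normal on the Neumann part requires.\<close>

lemma C_k_SucI:
  assumes "\<And>x. (f has_derivative f' x) (at x)" "\<And>v. C_k k (\<lambda>x. f' x v)"
  shows "C_k (Suc k) f"
proof -
  have "frechet_derivative f (at x) = f' x" for x
    using frechet_derivative_at[OF assms(1)] by simp
  then show ?thesis
    using assms by (auto simp: differentiable_def)
qed

lemma C_k_Suc_has_derivative:
  "C_k (Suc k) f \<Longrightarrow> (f has_derivative frechet_derivative f (at x)) (at x)"
  by (simp flip: frechet_derivative_works)

lemma C_k_Suc_D: "C_k (Suc k) f \<Longrightarrow> C_k k f"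
proof (induction k arbitrary: f)
  case 0
  then show ?case
    by (auto intro!: continuous_at_imp_continuous_on differentiable_imp_continuous_within)
qed auto

lemma C_k_continuous_on: "C_k k f \<Longrightarrow> continuous_on S f"
proof (induction k)
  case 0
  then show ?case by (auto intro: continuous_on_subset)
qed (use C_k_Suc_D in blast)

lemma C_k_const [simp]: "C_k k (\<lambda>x. c)"
proof (induction k arbitrary: c)
  case (Suc k)
  show ?case by (rule C_k_SucI[where f'="\<lambda>_ _. 0"]) (use Suc in auto)
qed simp

lemma C_k_bounded_linear: "bounded_linear f \<Longrightarrow> C_k k f"
proof (cases k)
  case 0
  then show "bounded_linear f \<Longrightarrow> C_k k f" by (simp add: linear_continuous_on)
next
  case (Suc n)
  assume "bounded_linear f"
  then show ?thesis unfolding Suc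
    by (intro C_k_SucI[where f'="\<lambda>_. f"]) (auto intro: bounded_linear_imp_has_derivative)
qed

lemma C_k_id [simp]: "C_k k (\<lambda>x. x)"
  by (intro C_k_bounded_linear bounded_linear_ident)

lemma C_k_add: "C_k k f \<Longrightarrow> C_k k g \<Longrightarrow> C_k k (\<lambda>x. f x + g x)"
proof (induction k arbitrary: f g)
  case 0
  then show ?case by (auto intro: continuous_on_add)
next
  case (Suc k)
  show ?case
    by (rule C_k_SucI, rule has_derivative_add)
      (use Suc in \<open>auto intro!: C_k_Suc_has_derivative Suc.IH\<close>)
qed

lemma C_k_scaleR:
  fixes f :: "'a::real_normed_vector \<Rightarrow> real" and g :: "'a \<Rightarrow> 'b::real_normed_vector"
  shows "C_k k f \<Longrightarrow> C_k k g \<Longrightarrow> C_k k (\<lambda>x. f x *\<^sub>R g x)"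
proof (induction k arbitrary: f g)
  case 0
  then show ?case by (auto intro: continuous_on_scaleR)
next
  case (Suc k)
  have "C_k k f" "C_k k g" using Suc.prems C_k_Suc_D by blast+
  then have "C_k k (\<lambda>x. f x *\<^sub>R frechet_derivative g (at x) v +
      frechet_derivative f (at x) v *\<^sub>R g x)" for v
    using Suc by (intro C_k_add Suc.IH) auto
  then show ?case
    using Suc.prems
    by (intro C_k_SucI[OF has_derivative_scaleR[OF C_k_Suc_has_derivative C_k_Suc_has_derivative]])
qed

lemma C_k_mult: "C_k k f \<Longrightarrow> C_k k g \<Longrightarrow> C_k k (\<lambda>x. f x * g x :: real)"
  using C_k_scaleR[of k f g] by simp

lemma C_k_cmult: "C_k k f \<Longrightarrow> C_k k (\<lambda>x. c * f x :: real)"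
  by (intro C_k_mult) auto

lemma C_k_diff: "C_k k f \<Longrightarrow> C_k k g \<Longrightarrow> C_k k (\<lambda>x. f x - g x :: real)"
  using C_k_add[of k f "\<lambda>x. (-1) * g x"] C_k_cmult[of k g "-1"] by simp

lemma C_k_Suc_realI:
  assumes "\<And>x. (f has_real_derivative f' x) (at x)" "C_k k f'"
  shows "C_k (Suc k) f"
  using assms by (intro C_k_SucI[where f'="\<lambda>x v. f' x * v"] C_k_mult)
    (auto simp: has_field_derivative_def)

lemma C_k_Suc_realE:
  fixes f :: "real \<Rightarrow> real"
  assumes "C_k (Suc k) f"
  obtains f' where "\<And>x. (f has_real_derivative f' x) (at x)" "C_k k f'"
proof
  let ?f' = "\<lambda>x. frechet_derivative f (at x) 1"
  show "(f has_real_derivative ?f' x) (at x)" for x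
  proof -
    have D: "(f has_derivative frechet_derivative f (at x)) (at x)"
      using assms by (rule C_k_Suc_has_derivative)
    have "frechet_derivative f (at x) t = ?f' x * t" for t
      using linear_scale[OF has_derivative_linear[OF D], of t 1] by simp
    then have "frechet_derivative f (at x) = (*) (?f' x)" by blast
    then show ?thesis using D by (simp add: has_field_derivative_def)
  qed
  show "C_k k ?f'" using assms by simp
qed

lemma C_k_compose_real:
  fixes f :: "real \<Rightarrow> real"
  shows "C_k k f \<Longrightarrow> C_k k g \<Longrightarrow> C_k k (\<lambda>x. f (g x))"
proof (induction k arbitrary: f g)
  case 0
  then show ?case by (auto intro: continuous_on_compose2)
next
  case (Suc k)
  obtain f' where f': "\<And>x. (f has_real_derivative f' x) (at x)" "C_k k f'"
    using C_k_Suc_realE[OF Suc.prems(1)] by blast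
  have "((\<lambda>x. f (g x)) has_derivative (\<lambda>v. f' (g x) * frechet_derivative g (at x) v)) (at x)" for x
    using has_derivative_compose[OF C_k_Suc_has_derivative[OF Suc.prems(2)], of f] f'(1)
    by (auto simp: has_field_derivative_def)
  moreover have "C_k k (\<lambda>x. f' (g x))"
    using Suc.IH[OF f'(2)] Suc.prems C_k_Suc_D by blast
  then have "C_k k (\<lambda>x. f' (g x) * frechet_derivative g (at x) v)" for v
    using Suc.prems by (intro C_k_mult) auto
  ultimately show ?case by (rule C_k_SucI)
qed

lemma C_k_inner_self: "C_k k (\<lambda>x::'a::euclidean_space. x \<bullet> x)"
proof (cases k)
  case (Suc n)
  have "bounded_linear (\<lambda>x::'a. 2 * (x \<bullet> v))" for v
    using bounded_linear_inner_left[of "2 *\<^sub>R v"] by simp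
  moreover have "((\<lambda>x. x \<bullet> x) has_derivative (\<lambda>v. 2 * (x \<bullet> v))) (at x)" for x :: 'a
    using has_derivative_inner[OF has_derivative_ident has_derivative_ident, of x UNIV]
    by (simp add: inner_commute)
  ultimately show ?thesis unfolding Suc
    using C_k_SucI[of "\<lambda>x::'a. x \<bullet> x" "\<lambda>x v. 2 * (x \<bullet> v)"] C_k_bounded_linear by blast
qed (simp add: continuous_on_inner)

lemma C_k_real_polynomial_function:
  fixes f :: "real \<Rightarrow> real"
  shows "real_polynomial_function f \<Longrightarrow> C_k k f"
  by (induction rule: real_polynomial_function.induct)
    (erule C_k_bounded_linear, rule C_k_const, erule (1) C_k_add, erule (1) C_k_mult)

text \<open>The flat function exp(-1/x), with the factor x^(-n) added so that the family is closed
  under differentiation up to linear combinations. Smoothness of all members then follows by one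
  induction.\<close>

definition flat_exp :: "nat \<Rightarrow> real \<Rightarrow> real" where
  "flat_exp n x = (if x > 0 then exp (- 1 / x) / x ^ n else 0)"

lemma power_div_fact_le_exp:
  assumes "0 \<le> (x::real)"
  shows "x ^ n / fact n \<le> exp x"
  using sum_le_suminf[OF summable_exp[of x], of "{n}"] assms
  by (simp add: exp_def divide_inverse mult.commute)

text \<open>The term of degree n + 2 of the exponential series at 1/x beats x^(-n) by two powers of
  x. A quadratic bound is what differentiability at 0 needs.\<close>

lemma flat_exp_bound: "\<bar>flat_exp n x\<bar> \<le> fact (n + 2) * x\<^sup>2"
proof (cases "x > 0")
  case True
  have "(1 / x) ^ (n + 2) / fact (n + 2) \<le> exp (1 / x)"
    using True by (intro power_div_fact_le_exp) simp
  then have "exp (- 1 / x) \<le> fact (n + 2) * x ^ (n + 2)"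
    using True
    by (simp add: exp_minus power_divide divide_simps mult.commute del: fact_Suc add_2_eq_Suc')
  then have "exp (- 1 / x) / x ^ n \<le> fact (n + 2) * x\<^sup>2"
    using True by (simp add: power_add divide_simps mult_ac del: fact_Suc add_2_eq_Suc')
  then show ?thesis
    using True by (simp add: flat_exp_def del: fact_Suc add_2_eq_Suc')
qed (simp add: flat_exp_def)

lemma flat_exp_has_derivative:
  "(flat_exp n has_real_derivative flat_exp (n + 2) x - real n * flat_exp (n + 1) x) (at x)"
proof -
  consider "x > 0" | "x = 0" | "x < 0" by linarith
  then show ?thesis
  proof cases
    case 1
    have "((\<lambda>x. exp (- 1 / x) / x ^ n) has_real_derivative
        flat_exp (n + 2) x - real n * flat_exp (n + 1) x) (at x)"
    proof (cases n)
      case 0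
      then show ?thesis using 1
        by (auto intro!: derivative_eq_intros simp: flat_exp_def power2_eq_square)
    next
      case (Suc m)
      show ?thesis unfolding Suc using 1
        by (auto intro!: derivative_eq_intros simp: flat_exp_def divide_simps power2_eq_square)
          (simp add: algebra_simps, cases m, simp_all)
    qed
    then show ?thesis
      by (rule has_field_derivative_transform_within_open[where S="{0<..}"])
        (use 1 in \<open>auto simp: flat_exp_def\<close>)
  next
    case 2
    \<comment> \<open>The difference quotient at 0; the quadratic bound leaves one factor |h| after
      division.\<close>
    have "(\<lambda>h. flat_exp n h / h) \<midarrow>0\<rightarrow> 0"
    proof (rule Lim_null_comparison)
      have "norm (flat_exp n h / h) \<le> fact (n + 2) * \<bar>h\<bar>" if "h \<noteq> 0" for h
      proof -
        have "\<bar>flat_exp n h\<bar> \<le> (fact (n + 2) * \<bar>h\<bar>) * \<bar>h\<bar>"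
          using flat_exp_bound[of n h] by (simp add: power2_eq_square mult.assoc abs_mult_self_eq)
        then have "\<bar>flat_exp n h\<bar> / \<bar>h\<bar> \<le> fact (n + 2) * \<bar>h\<bar>"
          using that by (subst pos_divide_le_eq) auto
        then show ?thesis by (simp only: real_norm_def abs_divide)
      qed
      then show "\<forall>\<^sub>F h in at 0. norm (flat_exp n h / h) \<le> fact (n + 2) * \<bar>h\<bar>"
        by (intro eventually_at_filter[THEN iffD2] always_eventually allI impI)
      show "((\<lambda>h. fact (n + 2) * \<bar>h\<bar>) \<longlongrightarrow> 0) (at (0::real))"
        by (auto intro!: tendsto_eq_intros)
    qed
    then show ?thesis using 2 by (simp add: DERIV_def flat_exp_def)
  next
    case 3
    have "((\<lambda>x. 0) has_real_derivative flat_exp (n + 2) x - real n * flat_exp (n + 1) x) (at x)"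
      using 3 by (auto simp: flat_exp_def)
    then show ?thesis
      by (rule has_field_derivative_transform_within_open[where S="{..<0}"])
        (use 3 in \<open>auto simp: flat_exp_def\<close>)
  qed
qed

lemma C_k_flat_exp: "C_k k (flat_exp n)"
proof (induction k arbitrary: n)
  case 0
  show ?case
    using DERIV_continuous[OF flat_exp_has_derivative[of n]] by (simp add: continuous_at_imp_continuous_on)
next
  case (Suc k)
  then show ?case by (intro C_k_Suc_realI[OF flat_exp_has_derivative] C_k_diff C_k_cmult)
qed

text \<open>Integration over the whole line makes the derivative two-sided at every point. The
  normalisation at \<open>c\<close> is used later to make antiderivatives vanish at the Dirichlet
  end.\<close>

lemma continuous_antiderivative:
  fixes f :: "real \<Rightarrow> real"
  assumes "continuous_on UNIV f"
  obtains F where "\<And>x. (F has_real_derivative f x) (at x)" "F c = 0"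
proof -
  have "\<exists>F. \<forall>x. -\<infinity> < ereal x \<longrightarrow> ereal x < \<infinity> \<longrightarrow> (F has_vector_derivative f x) (at x)"
    using assms by (intro einterval_antiderivative) (auto simp: continuous_on_eq_continuous_at)
  then obtain F where "\<And>x. (F has_real_derivative f x) (at x)"
    by (auto simp: has_real_derivative_iff_has_vector_derivative)
  then have "\<And>x. ((\<lambda>x. F x - F c) has_real_derivative f x) (at x)"
    by (auto intro!: derivative_eq_intros)
  then show ?thesis by (rule that) simp
qed

lemma smooth_step_exists:
  obtains \<sigma> :: "real \<Rightarrow> real" where "\<And>k. C_k k \<sigma>" "\<And>x. 0 \<le> \<sigma> x" "\<And>x. \<sigma> x \<le> 1"
    "\<And>x. x \<le> 1 \<Longrightarrow> \<sigma> x = 0" "\<And>x. x \<ge> 2 \<Longrightarrow> \<sigma> x = 1"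
proof -
  \<comment> \<open>A smooth bump that is positive exactly on (1, 2). The step is its antiderivative
    divided by the total mass \<open>F 2\<close>.\<close>
  define b where "b x = flat_exp 0 (x - 1) * flat_exp 0 (2 - x)" for x
  have Cb: "C_k k b" for k
    unfolding b_def by (intro C_k_mult C_k_compose_real[OF C_k_flat_exp] C_k_diff) auto
  have b0: "b x \<ge> 0" for x by (simp add: b_def flat_exp_def)
  obtain F where F: "\<And>x. (F has_real_derivative b x) (at x)" "F 1 = 0"
    using continuous_antiderivative[OF C_k_continuous_on[OF Cb]] by blast
  have mono: "F x \<le> F y" if "x \<le> y" for x y
    using DERIV_nonneg_imp_nondecreasing[OF that, of F] F(1) b0 by blast
  have cont: "continuous_on S F" for S
    using F(1) DERIV_isCont by (blast intro: continuous_at_imp_continuous_on)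
  have const: "F x = F y" if "x < y" "y \<le> 1 \<or> x \<ge> 2" for x y
  proof -
    have "(F has_real_derivative 0) (at z)" if "x < z" "z < y" for z
      using F(1)[of z] that \<open>y \<le> 1 \<or> x \<ge> 2\<close> by (auto simp: b_def flat_exp_def)
    then show ?thesis using DERIV_isconst_end[OF that(1) cont] by simp
  qed
  have low: "F x = 0" if "x \<le> 1" for x
    using that const[of x 1] F(2) by (cases "x = 1") auto
  have high: "F x = F 2" if "x \<ge> 2" for x
    using that const[of 2 x] by (cases "x = 2") auto
  have pos: "F 2 > 0"
  proof -
    have "F 1 < F 2"
    proof (rule DERIV_pos_imp_increasing_open[of 1 2 F])
      fix x :: real assume "1 < x" "x < 2"
      then have "b x > 0" by (simp add: b_def flat_exp_def)
      then show "\<exists>y. (F has_real_derivative y) (at x) \<and> 0 < y" using F by blast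
    qed (simp_all add: cont)
    then show ?thesis using F by simp
  qed
  have range: "0 \<le> F x \<and> F x \<le> F 2" for x
  proof -
    consider "x \<le> 1" | "1 \<le> x" "x \<le> 2" | "2 \<le> x" by linarith
    then show ?thesis
    proof cases
      case 1
      then show ?thesis using low[of x] pos by linarith
    next
      case 2
      then show ?thesis using mono[of 1 x] mono[of x 2] F(2) by linarith
    next
      case 3
      then show ?thesis using high[of x] pos by linarith
    qed
  qed
  have CF: "C_k k F" for k
    by (rule C_k_Suc_D[OF C_k_Suc_realI[OF F(1) Cb]])
  show ?thesis
  proof (rule that[of "\<lambda>x. 1 / F 2 * F x"])
    show "C_k k (\<lambda>x. 1 / F 2 * F x)" for k by (rule C_k_cmult[OF CF])
    show "0 \<le> 1 / F 2 * F x" "1 / F 2 * F x \<le> 1" for x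
      using range[of x] pos by (simp_all add: divide_simps)
    show "1 / F 2 * F x = 0" if "x \<le> 1" for x using low[OF that] by simp
    show "1 / F 2 * F x = 1" if "2 \<le> x" for x using high[OF that] pos by simp
  qed
qed


section \<open>Integration of radial functions\<close>

text \<open>Instead of polar coordinates, the image of Lebesgue measure under x \<bullet> x is
  identified through its values on half-lines. These are volumes of spherical shells, hence
  differences of ball volumes, and the same differences arise by integrating the density
  \<open>C * s powr (d / 2 - 1)\<close>.\<close>

lemma integral_radial_annulus:
  fixes g :: "real \<Rightarrow> real" and r R :: real
  defines "C \<equiv> unit_ball_vol (real DIM('a::euclidean_space)) * (real DIM('a) / 2)"
  assumes r: "0 < r" "r < R" and g: "continuous_on {r\<^sup>2..R\<^sup>2} g"
  shows "(LINT x:(annulus r R :: 'a set)|lborel. g (x \<bullet> x)) =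
           C * integral {r\<^sup>2..R\<^sup>2} (\<lambda>s. g s * s powr (real DIM('a) / 2 - 1))"
proof -
  define d where "d = real DIM('a)"
  define V where "V = unit_ball_vol d"
  define a where "a = r\<^sup>2"
  define b where "b = R\<^sup>2"
  define A where "A = (annulus r R :: 'a set)"
  have d: "d \<ge> 1" unfolding d_def using DIM_positive[where 'a='a] by (simp add: Suc_le_eq)
  have C: "C = V * (d / 2)" by (simp add: C_def V_def d_def)
  have V: "V > 0" using d by (simp add: V_def)
  have ab: "0 < a" "a < b" using r by (auto simp: a_def b_def power_strict_mono)
  define w where "w s = C * s powr (d / 2 - 1)" for s
  have w0: "w s \<ge> 0" for s using V d by (simp add: w_def C)
  have [measurable]: "A \<in> sets borel"
    unfolding A_def annulus_def by measurable
  have [measurable]: "w \<in> borel_measurable borel" unfolding w_def by measurable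
  define M where "M = distr (density lborel (indicator A)) borel (\<lambda>x::'a. x \<bullet> x)"
  define N where "N = density lborel (\<lambda>s. ennreal (indicator {a..b} s * w s))"
  have sq: "u\<^sup>2 < v\<^sup>2 \<longleftrightarrow> u < v" if "0 \<le> u" "0 \<le> v" for u v :: real
    using power_mono_iff[of v u 2] that by (meson not_le pos2)
  have pow_half: "u ^ DIM('a) = (u\<^sup>2) powr (d / 2)" if "u > 0" for u
  proof -
    have "(u\<^sup>2) powr (d / 2) = (u powr 2) powr (d / 2)"
      using that by (simp add: powr_numeral)
    also have "\<dots> = u powr d" by (simp add: powr_powr)
    also have "\<dots> = u ^ DIM('a)" using that by (simp add: d_def powr_realpow)
    finally show ?thesis ..
  qed
  have A_eq: "A = {y. a < y \<bullet> y \<and> y \<bullet> y < b}"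
    using r unfolding A_def annulus_def a_def b_def
    by (simp add: dot_square_norm sq)
  have M_tail: "emeasure M {x<..} = (if max a x < b then ennreal (V * b powr (d / 2) - V * max a x powr (d / 2)) else 0)" for x
  proof -
    have "emeasure M {x<..} = emeasure lborel {y \<in> A. x < y \<bullet> y}"
    proof -
      have "emeasure M {x<..} = (\<integral>\<^sup>+y. indicator A y * indicator {y. x < y \<bullet> y} y \<partial>lborel)"
        unfolding M_def by (subst emeasure_distr) (simp_all add: emeasure_density vimage_def)
      also have "\<dots> = (\<integral>\<^sup>+y. indicator {y \<in> A. x < y \<bullet> y} y \<partial>lborel)"
        by (intro nn_integral_cong) (simp add: indicator_def)
      finally show ?thesis by simp
    qed
    also have "\<dots> = (if max a x < b then ennreal (V * b powr (d / 2) - V * max a x powr (d / 2)) else 0)"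
    proof (cases "max a x < b")
      case True
      define t where "t = sqrt (max a x)"
      have t: "t > 0" "t < R" "t\<^sup>2 = max a x"
        using ab True r by (auto simp: t_def b_def max_def intro: real_less_lsqrt)
      have "{y \<in> A. x < y \<bullet> y} = ball 0 R - cball 0 t"
      proof (intro set_eqI)
        fix y :: 'a
        have "y \<in> {y \<in> A. x < y \<bullet> y} \<longleftrightarrow> max a x < y \<bullet> y \<and> y \<bullet> y < b"
          by (auto simp: A_eq)
        also have "\<dots> \<longleftrightarrow> t < norm y \<and> norm y < R"
          using t(1) r unfolding dot_square_norm b_def t(3)[symmetric] by (simp add: sq)
        finally show "y \<in> {y \<in> A. x < y \<bullet> y} \<longleftrightarrow> y \<in> ball 0 R - cball 0 t" by auto
      qed
      moreover have "emeasure lborel (ball (0::'a) R - cball 0 t) =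
          emeasure lborel (ball (0::'a) R) - emeasure lborel (cball (0::'a) t)"
      proof (rule emeasure_Diff)
        show "emeasure lborel (cball (0::'a) t) \<noteq> \<infinity>"
          using emeasure_lborel_cball_finite[of "0::'a" t] by simp
        show "cball (0::'a) t \<subseteq> ball 0 R" using t(2) by auto
      qed auto
      ultimately have "emeasure lborel {y \<in> A. x < y \<bullet> y} = emeasure lborel (ball (0::'a) R) - emeasure lborel (cball (0::'a) t)"
        by (simp only:)
      also have "\<dots> = ennreal (V * R ^ DIM('a) - V * t ^ DIM('a))"
        using t r V unfolding V_def d_def
        by (subst emeasure_ball, simp, subst emeasure_cball, simp, subst ennreal_minus) simp_all
      also have "R ^ DIM('a) = b powr (d / 2)"
        using pow_half[of R] r by (simp add: b_def)
      also have "t ^ DIM('a) = max a x powr (d / 2)"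
        using pow_half[of t] t by simp
      finally show ?thesis using True by simp
    next
      case False
      then have "{y \<in> A. x < y \<bullet> y} = {}" by (auto simp: A_eq)
      then have "emeasure lborel {y \<in> A. x < y \<bullet> y} = 0" by (simp only: emeasure_empty)
      with False show ?thesis by (simp only: if_False)
    qed
    finally show ?thesis .
  qed
  have N_tail: "emeasure N {x<..} = (if max a x < b then ennreal (V * b powr (d / 2) - V * max a x powr (d / 2)) else 0)" for x
  proof -
    have "emeasure N {x<..} = (\<integral>\<^sup>+s. ennreal (indicator {a..b} s * w s) * indicator {x<..} s \<partial>lborel)"
      unfolding N_def by (subst emeasure_density) auto
    \<comment> \<open>The two integrands can differ only at the left end \<open>x\<close>, a null
      set.\<close>
    also have "\<dots> = (\<integral>\<^sup>+s. ennreal (w s) * indicator {max a x..b} s \<partial>lborel)"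
    proof (rule nn_integral_cong_AE)
      show "AE s in lborel. ennreal (indicator {a..b} s * w s) * indicator {x<..} s = ennreal (w s) * indicator {max a x..b} s"
        using AE_lborel_singleton[of x] by eventually_elim (auto simp: indicator_def)
    qed
    also have "\<dots> = (if max a x < b then ennreal (V * b powr (d / 2) - V * max a x powr (d / 2)) else 0)"
    proof (cases "max a x < b")
      case True
      then show ?thesis
      proof (simp only: if_True, intro nn_integral_FTC_Icc)
        fix s assume "s \<in> {max a x..b}"
        then have "s > 0" using ab by auto
        then show "((\<lambda>s. V * s powr (d / 2)) has_real_derivative w s) (at s)"
          by (auto intro!: derivative_eq_intros simp: w_def C)
      qed (use w0 in auto)
    next
      case False
      then have "AE s in lborel. ennreal (w s) * indicator {max a x..b} s = 0"
        using AE_lborel_singleton[of b] by (auto elim!: eventually_mono simp: indicator_def)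
      then have "(\<integral>\<^sup>+s. ennreal (w s) * indicator {max a x..b} s \<partial>lborel) = 0"
        by (subst nn_integral_0_iff_AE) auto
      with False show ?thesis by (simp only: if_False)
    qed
    finally show ?thesis .
  qed
  \<comment> \<open>Both measures are finite on every half-line, and half-lines determine such a
    measure.\<close>
  have MN: "M = N"
    by (rule measure_eqI_lessThan) (auto simp: M_tail N_tail, auto simp: M_def N_def)
  \<comment> \<open>Extension by zero: \<open>g\<close> is controlled only on the interval, but the
    change of variables needs a Borel function on the line.\<close>
  define G where "G s = indicator {a..b} s * g s" for s
  have [measurable]: "G \<in> borel_measurable borel"
    using borel_measurable_continuous_on_indicator[of "{a..b}" g] g
    by (simp add: G_def[abs_def] a_def b_def)
  have "(LINT x:A|lborel. g (x \<bullet> x)) = (\<integral>x. indicator A x *\<^sub>R G (x \<bullet> x) \<partial>lborel)"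
    unfolding set_lebesgue_integral_def
    by (intro Bochner_Integration.integral_cong) (auto simp: A_eq G_def indicator_def)
  also have "\<dots> = (\<integral>x. G (x \<bullet> x) \<partial>density lborel (\<lambda>x. ennreal (indicator A x)))"
    by (subst integral_density) auto
  also have "\<dots> = (\<integral>s. G s \<partial>M)"
    unfolding M_def by (subst integral_distr) (auto simp: ennreal_indicator)
  also have "\<dots> = (\<integral>s. (indicator {a..b} s * w s) *\<^sub>R G s \<partial>lborel)"
    unfolding MN N_def by (subst integral_density) (use w0 in auto)
  also have "\<dots> = (LINT s:{a..b}|lborel. g s * w s)"
    unfolding set_lebesgue_integral_def
    by (intro Bochner_Integration.integral_cong) (auto simp: G_def indicator_def)
  also have "\<dots> = integral {a..b} (\<lambda>s. g s * w s)"
    unfolding w_def using g ab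
    by (intro set_borel_integral_eq_integral borel_integrable_atLeastAtMost' continuous_intros)
      (auto simp: a_def b_def)
  also have "\<dots> = C * integral {a..b} (\<lambda>s. g s * s powr (d / 2 - 1))"
    unfolding w_def by (simp add: mult.left_commute)
  finally show ?thesis by (simp add: A_def a_def b_def d_def)
qed


section \<open>A one-dimensional eigenvalue equation\<close>

text \<open>The threshold 1/(\<theta> - 1) is where 1 + h = \<theta> h. The point is that the factor
  of \<open>h powr p\<close> can be taken as close to 1 as desired, at the cost of a large additive
  constant.\<close>

lemma powr_one_plus_le:
  fixes h p \<theta> :: real
  assumes "0 \<le> h" "1 < p" "1 < \<theta>"
  shows "(1 + h) powr p \<le> \<theta> powr p * h powr p + (1 + 1 / (\<theta> - 1)) powr p"
proof (cases "h \<ge> 1 / (\<theta> - 1)")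
  case True
  then have "1 + h \<le> \<theta> * h" using assms by (simp add: field_simps)
  then have "(1 + h) powr p \<le> (\<theta> * h) powr p" using assms by (intro powr_mono2) auto
  also have "\<dots> = \<theta> powr p * h powr p" using assms by (simp add: powr_mult)
  finally show ?thesis by (simp add: add_increasing2)
next
  case False
  then have "(1 + h) powr p \<le> (1 + 1 / (\<theta> - 1)) powr p"
    using assms by (intro powr_mono2) auto
  then show ?thesis by (simp add: add_increasing)
qed

text \<open>The left end \<open>a\<close> carries the Neumann condition and the right end
  \<open>b\<close> the Dirichlet condition. Abstract weights allow the opposite arrangement to be
  treated by reflecting the interval.\<close>

locale weighted_interval =
  fixes m0 m1 :: "real \<Rightarrow> real" and p lam a b :: real
  assumes p: "p > 1" and ab: "a < b" and lam: "lam > 0"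
    and m0_cont: "continuous_on {a..b} m0" and m0_pos: "s \<in> {a..b} \<Longrightarrow> m0 s > 0"
    and m1_cont: "continuous_on {a..b} m1" and m1_pos: "s \<in> {a..b} \<Longrightarrow> m1 s > 0"
begin

definition I :: "(real \<Rightarrow> real) \<Rightarrow> real \<Rightarrow> real" where
  "I \<phi> s = integral {a..s} (\<lambda>\<tau>. m0 \<tau> * \<phi> \<tau> powr (p - 1))"

definition U :: "(real \<Rightarrow> real) \<Rightarrow> real \<Rightarrow> real" where
  "U \<phi> s = (lam / m1 s * I \<phi> s) powr (1 / (p - 1))"

text \<open>A positive fixed point of \<open>T\<close> solves \<open>(m1 \<bar>\<phi>'\<bar>\<^sup>p\<^sup>-\<^sup>1)' = lam m0 \<phi>\<^sup>p\<^sup>-\<^sup>1\<close>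
  with \<open>\<phi>'(a) = 0\<close> and \<open>\<phi>(b) = 1\<close>, and \<open>U \<phi> = - \<phi>'\<close>.\<close>

definition T :: "(real \<Rightarrow> real) \<Rightarrow> real \<Rightarrow> real" where
  "T \<phi> t = 1 + integral {t..b} (U \<phi>)"

text \<open>The lower bound 1 is the value that \<open>T\<close> prescribes at \<open>b\<close>. It
  is preserved because \<open>U\<close> is nonnegative, and it makes division by powers of \<phi>
  harmless.\<close>

definition admissible :: "(real \<Rightarrow> real) \<Rightarrow> bool" where
  "admissible \<phi> \<longleftrightarrow> continuous_on {a..b} \<phi> \<and> (\<forall>s\<in>{a..b}. 1 \<le> \<phi> s)"

section \<open>Regularity and monotonicity of the iteration map\<close>

lemma integrand_continuous:
  assumes "admissible \<phi>"
  shows "continuous_on {a..b} (\<lambda>s. m0 s * \<phi> s powr (p - 1))"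
  using assms by (intro continuous_on_mult m0_cont continuous_on_powr continuous_on_const)
    (force simp: admissible_def)+

lemma I_has_derivative:
  assumes "admissible \<phi>" "s \<in> {a..b}"
  shows "(I \<phi> has_real_derivative m0 s * \<phi> s powr (p - 1)) (at s within {a..b})"
  unfolding I_def[abs_def] using integral_has_real_derivative[OF integrand_continuous[OF assms(1)] assms(2)] .

lemma I_continuous: "admissible \<phi> \<Longrightarrow> continuous_on {a..b} (I \<phi>)"
  using I_has_derivative by (intro DERIV_continuous_on) auto

text \<open>For a non-integrable integrand the integral is 0 by convention, so the bound holds for
  arbitrary \<phi>.\<close>

lemma I_nonneg: "s \<in> {a..b} \<Longrightarrow> 0 \<le> I \<phi> s"
  unfolding I_def
proof (cases "(\<lambda>\<tau>. m0 \<tau> * \<phi> \<tau> powr (p - 1)) integrable_on {a..s}")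
  case True
  assume "s \<in> {a..b}"
  then show "0 \<le> integral {a..s} (\<lambda>\<tau>. m0 \<tau> * \<phi> \<tau> powr (p - 1))"
    using m0_pos by (intro integral_nonneg[OF True] mult_nonneg_nonneg less_imp_le[OF m0_pos]) auto
qed (simp add: not_integrable_integral)

lemma U_nonneg [simp]: "0 \<le> U \<phi> s"
  by (simp add: U_def)

lemma U_arg_nonneg: "s \<in> {a..b} \<Longrightarrow> 0 \<le> lam / m1 s * I \<phi> s"
  using I_nonneg[of s \<phi>] m1_pos[of s] lam by simp

lemma U_powr: "s \<in> {a..b} \<Longrightarrow> m1 s * U \<phi> s powr (p - 1) = lam * I \<phi> s"
  using U_arg_nonneg[of s \<phi>] m1_pos[of s] p lam I_nonneg[of s \<phi>] by (simp add: U_def powr_powr)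

lemma U_continuous:
  assumes "admissible \<phi>"
  shows "continuous_on {a..b} (U \<phi>)"
  unfolding U_def
proof (rule continuous_on_powr')
  show "continuous_on {a..b} (\<lambda>s. lam / m1 s * I \<phi> s)"
    using m1_pos by (intro continuous_on_mult continuous_on_divide continuous_on_const m1_cont I_continuous assms) force
qed (use U_arg_nonneg p in auto)

lemma T_has_derivative:
  assumes "admissible \<phi>" "s \<in> {a..b}"
  shows "(T \<phi> has_real_derivative - U \<phi> s) (at s within {a..b})"
  unfolding T_def[abs_def]
  using DERIV_add[OF DERIV_const integral_has_real_derivative'[OF U_continuous[OF assms(1)] assms(2)], of 1]
  by simp

lemma U_integrable: "admissible \<phi> \<Longrightarrow> a \<le> t \<Longrightarrow> U \<phi> integrable_on {t..b}"
  by (intro integrable_continuous_real continuous_on_subset[OF U_continuous]) auto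

lemma T_admissible:
  assumes "admissible \<phi>"
  shows "admissible (T \<phi>)"
  unfolding admissible_def
proof
  show "continuous_on {a..b} (T \<phi>)"
    using T_has_derivative[OF assms] by (intro DERIV_continuous_on) auto
  show "\<forall>s\<in>{a..b}. 1 \<le> T \<phi> s"
    using U_integrable[OF assms] by (auto simp: T_def intro!: integral_nonneg)
qed

lemma I_mono:
  assumes "admissible \<phi>" "admissible \<psi>" "\<And>s. s \<in> {a..b} \<Longrightarrow> \<phi> s \<le> \<psi> s" "s \<in> {a..b}"
  shows "I \<phi> s \<le> I \<psi> s"
  unfolding I_def
proof (rule integral_le)
  have sub: "{a..s} \<subseteq> {a..b}" using assms(4) by auto
  show "(\<lambda>\<tau>. m0 \<tau> * \<phi> \<tau> powr (p - 1)) integrable_on {a..s}"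
    by (rule integrable_continuous_real[OF continuous_on_subset[OF integrand_continuous[OF assms(1)] sub]])
  show "(\<lambda>\<tau>. m0 \<tau> * \<psi> \<tau> powr (p - 1)) integrable_on {a..s}"
    by (rule integrable_continuous_real[OF continuous_on_subset[OF integrand_continuous[OF assms(2)] sub]])
  fix \<tau> assume "\<tau> \<in> {a..s}"
  then have \<tau>: "\<tau> \<in> {a..b}" using sub by blast
  have "1 \<le> \<phi> \<tau>" using assms(1) \<tau> by (auto simp: admissible_def)
  then have "\<phi> \<tau> powr (p - 1) \<le> \<psi> \<tau> powr (p - 1)"
    using assms(3)[OF \<tau>] p by (intro powr_mono2) auto
  then show "m0 \<tau> * \<phi> \<tau> powr (p - 1) \<le> m0 \<tau> * \<psi> \<tau> powr (p - 1)"
    using m0_pos[OF \<tau>] by simp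
qed

lemma U_mono:
  assumes "admissible \<phi>" "admissible \<psi>" "\<And>s. s \<in> {a..b} \<Longrightarrow> \<phi> s \<le> \<psi> s" "s \<in> {a..b}"
  shows "U \<phi> s \<le> U \<psi> s"
  unfolding U_def using I_mono[OF assms] U_arg_nonneg[OF assms(4)] p m1_pos[OF assms(4)] lam
  by (intro powr_mono2 mult_left_mono) auto

lemma T_mono:
  assumes "admissible \<phi>" "admissible \<psi>" "\<And>s. s \<in> {a..b} \<Longrightarrow> \<phi> s \<le> \<psi> s" "s \<in> {a..b}"
  shows "T \<phi> s \<le> T \<psi> s"
  unfolding T_def using assms
  by (intro add_left_mono integral_le U_integrable U_mono) auto

text \<open>Integration by parts with \<open>T \<phi> - 1\<close> as multiplier. Both boundary terms
  vanish: this function is 0 at \<open>b\<close>, and \<open>I \<phi>\<close> is 0 at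
  \<open>a\<close>.\<close>

lemma energy_identity:
  assumes "admissible \<phi>"
  shows "integral {a..b} (\<lambda>s. U \<phi> s powr p * m1 s) =
    lam * integral {a..b} (\<lambda>s. (T \<phi> s - 1) * (m0 s * \<phi> s powr (p - 1)))"
proof -
  let ?f = "\<lambda>s. (T \<phi> s - 1) * (lam * (m0 s * \<phi> s powr (p - 1))) - U \<phi> s * (lam * I \<phi> s)"
  have "(?f has_integral (T \<phi> b - 1) * (lam * I \<phi> b) - (T \<phi> a - 1) * (lam * I \<phi> a)) {a..b}"
  proof (rule fundamental_theorem_of_calculus)
    fix s assume s: "s \<in> {a..b}"
    have "((\<lambda>s. (T \<phi> s - 1) * (lam * I \<phi> s)) has_real_derivative ?f s) (at s within {a..b})"
      using T_has_derivative[OF assms s] I_has_derivative[OF assms s]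
      by (auto intro!: derivative_eq_intros simp: algebra_simps)
    then show "((\<lambda>s. (T \<phi> s - 1) * (lam * I \<phi> s)) has_vector_derivative ?f s) (at s within {a..b})"
      by (simp add: has_real_derivative_iff_has_vector_derivative)
  qed (use ab in simp)
  moreover have "T \<phi> b = 1" "I \<phi> a = 0" by (simp_all add: T_def I_def)
  ultimately have 0: "integral {a..b} ?f = 0" by (simp add: integral_unique)
  have int1: "(\<lambda>s. (T \<phi> s - 1) * (lam * (m0 s * \<phi> s powr (p - 1)))) integrable_on {a..b}"
    using T_admissible[OF assms] integrand_continuous[OF assms]
    by (intro integrable_continuous_real
        continuous_on_mult integrand_continuous assms continuous_on_diff continuous_on_const)
      (auto simp: admissible_def)
  have int2: "(\<lambda>s. U \<phi> s * (lam * I \<phi> s)) integrable_on {a..b}"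
    using U_continuous[OF assms] I_continuous[OF assms]
    by (intro integrable_continuous_real continuous_on_mult continuous_on_const)
  have "integral {a..b} (\<lambda>s. U \<phi> s powr p * m1 s) = integral {a..b} (\<lambda>s. U \<phi> s * (lam * I \<phi> s))"
  proof (rule integral_cong)
    fix s assume s: "s \<in> {a..b}"
    have "U \<phi> s powr p = U \<phi> s * U \<phi> s powr (p - 1)"
      using powr_add[of "U \<phi> s" 1 "p - 1"] by simp
    then show "U \<phi> s powr p * m1 s = U \<phi> s * (lam * I \<phi> s)"
      using U_powr[OF s, of \<phi>] by (simp add: mult_ac)
  qed
  also have "\<dots> = integral {a..b} (\<lambda>s. (T \<phi> s - 1) * (lam * (m0 s * \<phi> s powr (p - 1))))"
    using 0 integral_diff[OF int1 int2] by simp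
  also have "\<dots> = lam * integral {a..b} (\<lambda>s. (T \<phi> s - 1) * (m0 s * \<phi> s powr (p - 1)))"
    by (simp add: mult.left_commute[of _ lam])
  finally show ?thesis .
qed

end

text \<open>The added inequality is the Rayleigh bound in one dimension for C^1 functions that
  vanish at the Dirichlet end. In the application \<open>al\<close> is the annulus
  eigenvalue.\<close>

locale weighted_hardy = weighted_interval +
  fixes al :: real
  assumes lam_less: "lam < al"
    and hardy: "\<lbrakk>continuous_on {a..b} u;
        \<And>s. s \<in> {a..b} \<Longrightarrow> (h has_real_derivative u s) (at s within {a..b}); h b = 0\<rbrakk> \<Longrightarrow>
      al * integral {a..b} (\<lambda>s. \<bar>h s\<bar> powr p * m0 s) \<le> integral {a..b} (\<lambda>s. \<bar>u s\<bar> powr p * m1 s)"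
begin

text \<open>With h = T \<phi> - 1, the energy identity bounds the energy E by lam times the integral
  of (1 + h)^p m0. This is at most lam2 times the integral of h^p m0 plus a constant, and the Hardy
  inequality turns it into (lam2 / al) E + K0. Since lam2 < al, the first term is absorbed on the
  left.\<close>

lemma energy_bound:
  obtains K where "\<And>\<phi>. admissible \<phi> \<Longrightarrow> (\<And>s. s \<in> {a..b} \<Longrightarrow> \<phi> s \<le> T \<phi> s) \<Longrightarrow>
    integral {a..b} (\<lambda>s. U \<phi> s powr p * m1 s) \<le> K"
proof -
  define lam2 where "lam2 = (lam + al) / 2"
  have lam2: "lam < lam2" "lam2 < al" using lam_less by (auto simp: lam2_def)
  \<comment> \<open>Chosen so that the loss factor turns \<open>lam\<close> into exactly
    \<open>lam2\<close>, the midpoint between \<open>lam\<close> and \<open>al\<close>.\<close>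
  define \<theta> where "\<theta> = (lam2 / lam) powr (1 / p)"
  have \<theta>: "\<theta> > 1" "lam * \<theta> powr p = lam2"
    using lam lam2 p by (auto simp: \<theta>_def powr_powr)
  define L where "L = (1 + 1 / (\<theta> - 1)) powr p"
  define K0 where "K0 = lam * integral {a..b} (\<lambda>s. L * m0 s)"
  show ?thesis
  proof (rule that[of "K0 / (1 - lam2 / al)"])
    fix \<phi> assume adm: "admissible \<phi>" and le: "\<And>s. s \<in> {a..b} \<Longrightarrow> \<phi> s \<le> T \<phi> s"
    define E where "E = integral {a..b} (\<lambda>s. U \<phi> s powr p * m1 s)"
    define h where "h s = T \<phi> s - 1" for s
    have admT: "admissible (T \<phi>)" by (rule T_admissible[OF adm])
    then have h: "h s \<ge> 0" if "s \<in> {a..b}" for s using that by (force simp: h_def admissible_def)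
    have h_cont: "continuous_on {a..b} h"
      using admT unfolding h_def admissible_def by (intro continuous_intros) auto
    have hp: "continuous_on {a..b} (\<lambda>s. h s powr p)"
      using h p by (intro continuous_on_powr' h_cont continuous_on_const) auto
    have "al * integral {a..b} (\<lambda>s. \<bar>h s\<bar> powr p * m0 s) \<le> integral {a..b} (\<lambda>s. \<bar>- U \<phi> s\<bar> powr p * m1 s)"
    proof (rule hardy)
      show "(h has_real_derivative - U \<phi> s) (at s within {a..b})" if "s \<in> {a..b}" for s
        unfolding h_def using T_has_derivative[OF adm that] by (auto intro!: derivative_eq_intros)
      show "continuous_on {a..b} (\<lambda>s. - U \<phi> s)"
        by (intro continuous_on_minus U_continuous[OF adm])
    qed (simp add: h_def T_def)
    also have "\<dots> = E" by (simp add: E_def)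
    also have "integral {a..b} (\<lambda>s. \<bar>h s\<bar> powr p * m0 s) = integral {a..b} (\<lambda>s. h s powr p * m0 s)"
      using h by (intro integral_cong) auto
    finally have *: "integral {a..b} (\<lambda>s. h s powr p * m0 s) \<le> E / al"
      using lam lam_less by (simp add: field_simps)
    have "E = lam * integral {a..b} (\<lambda>s. h s * (m0 s * \<phi> s powr (p - 1)))"
      using energy_identity[OF adm] by (simp add: E_def h_def)
    also have "\<dots> \<le> lam * integral {a..b} (\<lambda>s. \<theta> powr p * (h s powr p * m0 s) + L * m0 s)"
    proof (intro mult_left_mono integral_le)
      show "(\<lambda>s. h s * (m0 s * \<phi> s powr (p - 1))) integrable_on {a..b}"
        by (intro integrable_continuous_real continuous_on_mult h_cont integrand_continuous adm)
      show "(\<lambda>s. \<theta> powr p * (h s powr p * m0 s) + L * m0 s) integrable_on {a..b}"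
        by (intro integrable_continuous_real continuous_on_add continuous_on_mult
            continuous_on_const hp m0_cont)
      fix s assume s: "s \<in> {a..b}"
      have \<phi>: "1 \<le> \<phi> s" "\<phi> s \<le> 1 + h s" using adm s le[OF s] by (auto simp: admissible_def h_def)
      \<comment> \<open>Here \<phi> \<le> T \<phi> = 1 + h enters; the remaining factor h is crudely
        raised to 1 + h.\<close>
      have "h s * (m0 s * \<phi> s powr (p - 1)) \<le> (1 + h s) * (m0 s * (1 + h s) powr (p - 1))"
        using h[OF s] \<phi> m0_pos[OF s] p by (intro mult_mono powr_mono2) auto
      also have "\<dots> = (1 + h s) powr p * m0 s"
        using powr_add[of "1 + h s" 1 "p - 1"] h[OF s] by simp
      also have "\<dots> \<le> (\<theta> powr p * h s powr p + L) * m0 s"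
        unfolding L_def using h[OF s] p \<theta> m0_pos[OF s]
        by (intro mult_right_mono powr_one_plus_le) auto
      finally show "h s * (m0 s * \<phi> s powr (p - 1)) \<le> \<theta> powr p * (h s powr p * m0 s) + L * m0 s"
        by (simp add: algebra_simps)
    qed (use lam in auto)
    also have "integral {a..b} (\<lambda>s. \<theta> powr p * (h s powr p * m0 s) + L * m0 s) =
        \<theta> powr p * integral {a..b} (\<lambda>s. h s powr p * m0 s) + integral {a..b} (\<lambda>s. L * m0 s)"
    proof -
      have "(\<lambda>s. \<theta> powr p * (h s powr p * m0 s)) integrable_on {a..b}"
        "(\<lambda>s. L * m0 s) integrable_on {a..b}"
        by (intro integrable_continuous_real continuous_on_mult continuous_on_const hp m0_cont)+
      then show ?thesis by (simp add: integral_add)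
    qed
    also have "lam * \<dots> = lam2 * integral {a..b} (\<lambda>s. h s powr p * m0 s) + K0"
      by (simp add: K0_def ring_distribs flip: \<theta>(2))
    also have "\<dots> \<le> lam2 * (E / al) + K0"
      using * lam lam2 by (intro add_right_mono mult_left_mono) auto
    finally have "E * (1 - lam2 / al) \<le> K0" by (simp add: algebra_simps)
    then show "E \<le> K0 / (1 - lam2 / al)"
      using lam lam2 by (subst pos_le_divide_eq) (auto simp: field_simps)
  qed
qed

text \<open>In one dimension the energy controls the supremum: T \<phi> - 1 is at most the integral
  of U, and u \<le> 1 + u^p together with the minimum \<open>c\<close> of \<open>m1\<close> bounds
  that by the interval length plus E / c.\<close>

lemma sup_bound:
  obtains B where "B \<ge> 1" "\<And>\<phi> s. admissible \<phi> \<Longrightarrow> (\<And>s. s \<in> {a..b} \<Longrightarrow> \<phi> s \<le> T \<phi> s) \<Longrightarrow>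
    s \<in> {a..b} \<Longrightarrow> T \<phi> s \<le> B"
proof -
  obtain K where K: "\<And>\<phi>. admissible \<phi> \<Longrightarrow> (\<And>s. s \<in> {a..b} \<Longrightarrow> \<phi> s \<le> T \<phi> s) \<Longrightarrow>
    integral {a..b} (\<lambda>s. U \<phi> s powr p * m1 s) \<le> K" using energy_bound by blast
  obtain s0 where s0: "s0 \<in> {a..b}" "\<And>s. s \<in> {a..b} \<Longrightarrow> m1 s0 \<le> m1 s"
    using continuous_attains_inf[OF compact_Icc _ m1_cont] ab by auto
  define c where "c = m1 s0"
  have c: "c > 0" using m1_pos[OF s0(1)] by (simp add: c_def)
  show ?thesis
  proof (rule that[of "1 + ((b - a) + \<bar>K\<bar> / c)"])
    fix \<phi> t assume adm: "admissible \<phi>" and le: "\<And>s. s \<in> {a..b} \<Longrightarrow> \<phi> s \<le> T \<phi> s"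
      and t: "t \<in> {a..b}"
    have Up: "continuous_on {a..b} (\<lambda>s. U \<phi> s powr p)"
      using p by (intro continuous_on_powr' U_continuous adm continuous_on_const) auto
    have "integral {t..b} (U \<phi>) \<le> integral {a..b} (U \<phi>)"
      using t by (intro integral_subset_le U_integrable adm) auto
    also have "\<dots> \<le> integral {a..b} (\<lambda>s. 1 + (1 / c) * (U \<phi> s powr p * m1 s))"
    proof (rule integral_le)
      show "U \<phi> integrable_on {a..b}" by (rule U_integrable[OF adm]) simp
      show "(\<lambda>s. 1 + (1 / c) * (U \<phi> s powr p * m1 s)) integrable_on {a..b}"
        by (intro integrable_continuous_real continuous_on_add continuous_on_mult continuous_on_const Up m1_cont)
      fix s assume s: "s \<in> {a..b}"
      have "U \<phi> s \<le> 1 + U \<phi> s powr p"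
      proof (cases "U \<phi> s \<le> 1")
        case False
        then have "U \<phi> s powr 1 \<le> U \<phi> s powr p" using p by (intro powr_mono) auto
        then show ?thesis using False by simp
      qed (simp add: add_increasing2)
      also have "U \<phi> s powr p \<le> (1 / c) * (U \<phi> s powr p * m1 s)"
        using mult_left_mono[OF s0(2)[OF s], of "U \<phi> s powr p"] c by (simp add: c_def field_simps)
      finally show "U \<phi> s \<le> 1 + (1 / c) * (U \<phi> s powr p * m1 s)" by simp
    qed
    also have "\<dots> = (b - a) + (1 / c) * integral {a..b} (\<lambda>s. U \<phi> s powr p * m1 s)"
    proof -
      have "(\<lambda>s. (1 / c) * (U \<phi> s powr p * m1 s)) integrable_on {a..b}"
        by (intro integrable_continuous_real continuous_on_mult continuous_on_const Up m1_cont)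
      then show ?thesis using ab by (subst integral_add) (auto simp del: times_divide_eq_left)
    qed
    also have "\<dots> \<le> (b - a) + (1 / c) * \<bar>K\<bar>"
      using K[OF adm le] c by (intro add_left_mono mult_left_mono) auto
    finally show "T \<phi> t \<le> 1 + ((b - a) + \<bar>K\<bar> / c)" by (simp add: T_def)
  qed (use ab c in auto)
qed

text \<open>The iteration starts at 1, the smallest admissible function, so monotonicity of
  \<open>T\<close> makes it increasing. Thus every iterate satisfies \<phi> \<le> T \<phi>, which is
  what the uniform bound asks for.\<close>

lemma T_fixed_point:
  obtains \<Phi> where "admissible \<Phi>" "\<And>s. s \<in> {a..b} \<Longrightarrow> T \<Phi> s = \<Phi> s"
proof -
  define \<phi> where "\<phi> n = (T ^^ n) (\<lambda>_. 1)" for n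
  have \<phi>_Suc: "\<phi> (Suc n) = T (\<phi> n)" for n by (simp add: \<phi>_def)
  have const_adm: "admissible (\<lambda>_. c)" if "c \<ge> 1" for c using that by (simp add: admissible_def)
  have adm: "admissible (\<phi> n)" for n
  proof (induction n)
    case 0 then show ?case using const_adm[of 1] by (simp add: \<phi>_def)
  qed (simp add: \<phi>_Suc T_admissible)
  have \<phi>1: "1 \<le> \<phi> n s" if "s \<in> {a..b}" for n s using adm[of n] that by (auto simp: admissible_def)
  have mono: "\<phi> n s \<le> \<phi> (Suc n) s" if "s \<in> {a..b}" for n s
    using that
  proof (induction n arbitrary: s)
    case 0
    then show ?case using \<phi>1[OF 0, of 1] by (simp add: \<phi>_def)
  next
    case (Suc n)
    then show ?case unfolding \<phi>_Suc[of "Suc n"] \<phi>_Suc[of n]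
      by (intro T_mono T_admissible adm) (auto simp flip: \<phi>_Suc)
  qed
  obtain B where B: "B \<ge> 1" "\<And>\<phi> s. admissible \<phi> \<Longrightarrow> (\<And>s. s \<in> {a..b} \<Longrightarrow> \<phi> s \<le> T \<phi> s) \<Longrightarrow>
    s \<in> {a..b} \<Longrightarrow> T \<phi> s \<le> B" using sup_bound by blast
  have \<phi>B: "\<phi> n s \<le> B" if "s \<in> {a..b}" for n s
    using order_trans[OF mono[OF that] B(2)[OF adm mono[unfolded \<phi>_Suc] that, folded \<phi>_Suc]] .
  define \<Phi> where "\<Phi> s = lim (\<lambda>n. \<phi> n s)" for s
  have lim: "(\<lambda>n. \<phi> n s) \<longlonglongrightarrow> \<Phi> s" if "s \<in> {a..b}" for s
  proof -
    have "incseq (\<lambda>n. \<phi> n s)" using mono[OF that] by (intro incseq_SucI)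
    moreover have "\<forall>n. \<phi> n s \<le> B" using \<phi>B[OF that] by blast
    ultimately obtain L where "(\<lambda>n. \<phi> n s) \<longlonglongrightarrow> L"
      by (rule incseq_convergent)
    then show ?thesis by (simp add: \<Phi>_def limI)
  qed
  have \<Phi>1: "1 \<le> \<Phi> s" if "s \<in> {a..b}" for s
    using \<phi>1[OF that] by (intro LIMSEQ_le_const[OF lim[OF that]]) auto
  have I_lim: "(\<lambda>n. I (\<phi> n) s) \<longlonglongrightarrow> I \<Phi> s" if s: "s \<in> {a..b}" for s
    unfolding I_def
  proof (rule dominated_convergence(2))
    have sub: "{a..s} \<subseteq> {a..b}" using s by auto
    show "(\<lambda>\<tau>. m0 \<tau> * \<phi> n \<tau> powr (p - 1)) integrable_on {a..s}" for n
      by (intro integrable_continuous_real continuous_on_subset[OF integrand_continuous[OF adm] sub])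
    show "(\<lambda>\<tau>. m0 \<tau> * B powr (p - 1)) integrable_on {a..s}"
      by (intro integrable_continuous_real continuous_on_subset[OF integrand_continuous[OF const_adm[OF B(1)]] sub])
    fix \<tau> assume "\<tau> \<in> {a..s}"
    then have \<tau>: "\<tau> \<in> {a..b}" using sub by blast
    show "norm (m0 \<tau> * \<phi> n \<tau> powr (p - 1)) \<le> m0 \<tau> * B powr (p - 1)" for n
      using \<phi>1[OF \<tau>, of n] \<phi>B[OF \<tau>, of n] m0_pos[OF \<tau>] p
      by (auto simp: abs_mult intro!: mult_left_mono powr_mono2)
    show "(\<lambda>n. m0 \<tau> * \<phi> n \<tau> powr (p - 1)) \<longlonglongrightarrow> m0 \<tau> * \<Phi> \<tau> powr (p - 1)"
      using \<Phi>1[OF \<tau>] by (intro tendsto_intros lim[OF \<tau>]) auto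
  qed
  have U_lim: "(\<lambda>n. U (\<phi> n) s) \<longlonglongrightarrow> U \<Phi> s" if s: "s \<in> {a..b}" for s
    unfolding U_def
  proof (rule tendsto_powr')
    show "(\<lambda>n. lam / m1 s * I (\<phi> n) s) \<longlonglongrightarrow> lam / m1 s * I \<Phi> s"
      by (intro tendsto_mult tendsto_const I_lim[OF s])
  qed (use p U_arg_nonneg[OF s] in auto)
  \<comment> \<open>Monotonicity of \<open>U\<close> yields a majorant that does not depend on n:
    its value at the constant function \<open>B\<close>.\<close>
  have UB: "norm (U (\<phi> n) s) \<le> U (\<lambda>_. B) s" if "s \<in> {a..b}" for n s
    using U_mono[OF adm const_adm[OF B(1)] \<phi>B that, of n] by simp
  have dom: "U \<Phi> integrable_on {t..b}" "(\<lambda>n. integral {t..b} (U (\<phi> n))) \<longlonglongrightarrow> integral {t..b} (U \<Phi>)"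
    if t: "t \<in> {a..b}" for t
  proof -
    have 1: "U (\<phi> n) integrable_on {t..b}" "U (\<lambda>_. B) integrable_on {t..b}" for n
      using t by (auto intro: U_integrable adm const_adm[OF B(1)])
    have 2: "norm (U (\<phi> n) s) \<le> U (\<lambda>_. B) s" "(\<lambda>n. U (\<phi> n) s) \<longlonglongrightarrow> U \<Phi> s" if "s \<in> {t..b}" for n s
      using that t UB U_lim by auto
    show "U \<Phi> integrable_on {t..b}" "(\<lambda>n. integral {t..b} (U (\<phi> n))) \<longlonglongrightarrow> integral {t..b} (U \<Phi>)"
      using dominated_convergence[OF 1 2] by blast+
  qed
  have fixp: "T \<Phi> t = \<Phi> t" if t: "t \<in> {a..b}" for t
  proof -
    have "(\<lambda>n. \<phi> (Suc n) t) \<longlonglongrightarrow> T \<Phi> t"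
      unfolding \<phi>_Suc T_def by (intro tendsto_add tendsto_const dom(2)[OF t])
    moreover have "(\<lambda>n. \<phi> (Suc n) t) \<longlonglongrightarrow> \<Phi> t" using lim[OF t] by (rule LIMSEQ_Suc)
    ultimately show ?thesis by (rule LIMSEQ_unique)
  qed
  \<comment> \<open>A pointwise limit need not be continuous; continuity of \<Phi> is recovered from
    the fixed point equation, because T \<Phi> is an indefinite integral.\<close>
  have "continuous_on {a..b} (T \<Phi>)"
    unfolding T_def[abs_def] using dom(1)[of a] ab
    by (intro continuous_on_add continuous_on_const indefinite_integral_continuous_1') auto
  then have "continuous_on {a..b} \<Phi>"
    by (rule continuous_on_eq) (rule fixp)
  with \<Phi>1 fixp show ?thesis by (intro that[of \<Phi>]) (auto simp: admissible_def)
qed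

text \<open>The function is y = m1 (-\<Phi>' / \<Phi>)^(p-1), a weighted power of the logarithmic
  derivative; the numerator \<open>m1 s * U \<Phi> s powr (p - 1)\<close> equals
  \<open>lam * I \<Phi> s\<close>. The quotient rule applied to it produces the Riccati
  equation.\<close>

lemma riccati_solution:
  obtains y y' where "\<And>s. s \<in> {a..b} \<Longrightarrow> (y has_real_derivative y' s) (at s within {a..b})"
    "continuous_on {a..b} y'" "\<And>s. s \<in> {a..b} \<Longrightarrow> 0 \<le> y s"
    "\<And>s. s \<in> {a..b} \<Longrightarrow> y' s = lam * m0 s + (p - 1) * (m1 s * (y s / m1 s) powr (p / (p - 1)))"
proof -
  obtain \<Phi> where adm: "admissible \<Phi>" and fixp: "\<And>s. s \<in> {a..b} \<Longrightarrow> T \<Phi> s = \<Phi> s"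
    using T_fixed_point by blast
  have \<Phi>1: "1 \<le> \<Phi> s" if "s \<in> {a..b}" for s using adm that by (auto simp: admissible_def)
  have D\<Phi>: "(\<Phi> has_real_derivative - U \<Phi> s) (at s within {a..b})" if "s \<in> {a..b}" for s
    using has_field_derivative_transform_within[OF T_has_derivative[OF adm that] zero_less_one that] fixp
    by simp
  define y where "y s = lam * I \<Phi> s / \<Phi> s powr (p - 1)" for s
  \<comment> \<open>Taking the right-hand side of the equation as the definition lets continuity of
    y' follow from continuity of y.\<close>
  define y' where "y' s = lam * m0 s + (p - 1) * (m1 s * (y s / m1 s) powr (p / (p - 1)))" for s
  have y0: "0 \<le> y s" if "s \<in> {a..b}" for s
    using I_nonneg[OF that, of \<Phi>] lam by (simp add: y_def)
  have Dy: "(y has_real_derivative y' s) (at s within {a..b})" if s: "s \<in> {a..b}" for s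
  proof -
    let ?P = "\<Phi> s" and ?U = "U \<Phi> s"
    have P: "?P > 0" using \<Phi>1[OF s] by simp
    have "(y has_real_derivative
        (lam * (m0 s * ?P powr (p - 1)) * ?P powr (p - 1) -
         lam * I \<Phi> s * ((p - 1) * ?P powr (p - 1 - 1) * - ?U)) / (?P powr (p - 1) * ?P powr (p - 1)))
        (at s within {a..b})"
      unfolding y_def[abs_def]
      using DERIV_divide[OF DERIV_cmult[OF I_has_derivative[OF adm s], of lam]
          DERIV_chain2[OF has_real_derivative_powr[OF P, of "p - 1"] D\<Phi>[OF s]]] P
      by simp
    also have "(lam * (m0 s * ?P powr (p - 1)) * ?P powr (p - 1) -
         lam * I \<Phi> s * ((p - 1) * ?P powr (p - 1 - 1) * - ?U)) / (?P powr (p - 1) * ?P powr (p - 1)) = y' s"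
    proof -
      \<comment> \<open>The exponent p / (p - 1) undoes the power p - 1 and leaves the p-th power of
        U / \<Phi>.\<close>
      have "(y s / m1 s) = (?U / ?P) powr (p - 1)"
        unfolding y_def using U_powr[OF s, of \<Phi>] m1_pos[OF s] P
        by (simp add: powr_divide field_simps)
      then have "(y s / m1 s) powr (p / (p - 1)) = (?U / ?P) powr p"
        using p by (simp add: powr_powr)
      also have "\<dots> = ?U powr (p - 1) * ?U / (?P powr (p - 1) * ?P)"
        using powr_add[of ?U "p - 1" 1] powr_add[of ?P "p - 1" 1] P by (simp add: powr_divide)
      finally have 1: "m1 s * (y s / m1 s) powr (p / (p - 1)) = lam * I \<Phi> s * ?U / (?P powr (p - 1) * ?P)"
        using U_powr[OF s, of \<Phi>] by (simp add: mult.assoc[symmetric])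
      have "?P powr (p - 1) = ?P powr (p - 1 - 1 + 1)" by simp
      also have "\<dots> = ?P powr (p - 1 - 1) * ?P" unfolding powr_add using P by simp
      finally have e: "?P powr (p - 1 - 1) = ?P powr (p - 1) / ?P" using P by (simp add: field_simps)
      show ?thesis unfolding y'_def 1 e using P by (simp add: field_simps)
    qed
    finally show ?thesis .
  qed
  have "continuous_on {a..b} y" using Dy by (intro DERIV_continuous_on) auto
  then have "continuous_on {a..b} y'"
    unfolding y'_def using y0 m1_pos p
    by (intro continuous_on_add continuous_on_mult continuous_on_const m0_cont m1_cont
        continuous_on_powr' continuous_on_divide) (force intro: divide_nonneg_pos)+
  with Dy y0 y'_def show ?thesis by (intro that[of y y']) auto
qed

end


section \<open>The annulus eigenvalue and radial functions\<close>

lemma GDERIV_unique: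
  assumes "GDERIV f x :> D" "GDERIV f x :> D'"
  shows "D = D'"
proof -
  have "(\<lambda>h. h \<bullet> D) = (\<lambda>h. h \<bullet> D')"
    using assms unfolding gderiv_def by (rule has_derivative_unique)
  then show ?thesis by (metis vector_eq_ldot)
qed

lemma grad_eqI: "GDERIV f x :> D \<Longrightarrow> grad f x = D"
  unfolding grad_def using GDERIV_unique by blast

text \<open>The product form also covers a vanishing denominator. Otherwise \<zeta> is nonzero
  somewhere in \<Omega>, and the infimum is a lower bound because all quotients are
  nonnegative.\<close>

lemma rayleigh_quotient_le:
  assumes "\<zeta> \<in> test_functions D"
  shows "fundamental_eigenvalue \<Omega> D p * (LINT x:\<Omega>|lborel. \<bar>\<zeta> x\<bar> powr p) \<le>
    (LINT x:\<Omega>|lborel. norm (grad \<zeta> x) powr p)"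
proof (cases "(LINT x:\<Omega>|lborel. \<bar>\<zeta> x\<bar> powr p) = 0")
  case True
  have "0 \<le> (LINT x:\<Omega>|lborel. norm (grad \<zeta> x) powr p)"
    unfolding set_lebesgue_integral_def by (intro integral_nonneg_AE) (auto simp: indicator_def)
  with True show ?thesis by simp
next
  case False
  have nonneg: "0 \<le> (LINT x:\<Omega>|lborel. \<bar>\<eta> x\<bar> powr p)" "0 \<le> (LINT x:\<Omega>|lborel. norm (grad \<eta> x) powr p)"
    for \<eta> :: "real^'a \<Rightarrow> real"
    unfolding set_lebesgue_integral_def by (auto intro!: integral_nonneg_AE simp: indicator_def)
  have "\<exists>x\<in>\<Omega>. \<zeta> x \<noteq> 0"
  proof (rule ccontr)
    assume "\<not> ?thesis"
    then have "(\<lambda>x. indicator \<Omega> x *\<^sub>R \<bar>\<zeta> x\<bar> powr p) = (\<lambda>x. 0)" by (auto simp: indicator_def)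
    with False show False by (simp add: set_lebesgue_integral_def)
  qed
  then have "fundamental_eigenvalue \<Omega> D p \<le>
      (LINT x:\<Omega>|lborel. norm (grad \<zeta> x) powr p) / (LINT x:\<Omega>|lborel. \<bar>\<zeta> x\<bar> powr p)"
    unfolding fundamental_eigenvalue_def using assms nonneg
    by (intro cInf_lower bdd_belowI[of _ 0]) (auto intro!: divide_nonneg_nonneg)
  with False nonneg(1)[of \<zeta>] show ?thesis by (subst (asm) pos_le_divide_eq) auto
qed

lemma radial_test_function:
  fixes f :: "real \<Rightarrow> real"
  assumes "\<And>k. C_k k f" "\<And>s. s \<ge> M \<Longrightarrow> f s = 0" "0 < e" "\<And>s. \<bar>s - c\<bar> < e \<Longrightarrow> f s = 0"
  shows "(\<lambda>x. f (x \<bullet> x)) \<in> test_functions {x::real^'n. x \<bullet> x = c}"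
proof -
  \<comment> \<open>A closed set away from the sphere, so that passing to the closure in
    \<open>support\<close> does not reach it. This is why f has to vanish on a whole neighbourhood
    of \<open>c\<close>.\<close>
  let ?S = "{x::real^'n. x \<bullet> x \<le> M} \<inter> {x. e \<le> \<bar>x \<bullet> x - c\<bar>}"
  have S: "closed ?S"
    by (intro closed_Int closed_Collect_le continuous_on_inner continuous_on_id continuous_on_const
        continuous_on_diff continuous_on_rabs)
  have sub: "support (\<lambda>x::real^'n. f (x \<bullet> x)) \<subseteq> ?S"
    unfolding support_def
  proof (rule closure_minimal[OF _ S])
    show "{x::real^'n. f (x \<bullet> x) \<noteq> 0} \<subseteq> ?S"
    proof
      fix x :: "real^'n" assume "x \<in> {x. f (x \<bullet> x) \<noteq> 0}"
      then have "\<not> M \<le> x \<bullet> x" "\<not> \<bar>x \<bullet> x - c\<bar> < e" using assms(2,4) by blast+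
      then show "x \<in> ?S" by auto
    qed
  qed
  have "?S \<subseteq> cball 0 (sqrt M)"
    by (auto simp: norm_eq_sqrt_inner)
  then have "bounded (support (\<lambda>x::real^'n. f (x \<bullet> x)))"
    using sub bounded_cball bounded_subset by blast
  then have "compact (support (\<lambda>x::real^'n. f (x \<bullet> x)))"
    by (simp add: compact_eq_bounded_closed support_def)
  moreover have "support (\<lambda>x::real^'n. f (x \<bullet> x)) \<inter> {x. x \<bullet> x = c} = {}"
    using sub \<open>0 < e\<close> by auto
  ultimately show ?thesis
    unfolding test_functions_def using C_k_compose_real[OF assms(1) C_k_inner_self] by blast
qed

lemma GDERIV_radial:
  fixes f :: "real \<Rightarrow> real" and x :: "'a::real_inner"
  assumes "(f has_real_derivative f') (at (x \<bullet> x))"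
  shows "GDERIV (\<lambda>x. f (x \<bullet> x)) x :> (2 * f') *\<^sub>R x"
proof -
  have "((\<lambda>x. x \<bullet> x) has_derivative (\<lambda>v. 2 * (x \<bullet> v))) (at x)"
    using has_derivative_inner[OF has_derivative_ident has_derivative_ident, of x UNIV]
    by (simp add: inner_commute)
  then have "((\<lambda>x. f (x \<bullet> x)) has_derivative (\<lambda>v. f' * (2 * (x \<bullet> v)))) (at x)"
    using has_derivative_compose[of "\<lambda>x. x \<bullet> x" _ x UNIV f "(*) f'"] assms
    by (simp add: has_field_derivative_def)
  then show ?thesis by (simp add: gderiv_def inner_commute mult_ac)
qed

text \<open>The gradient contributes 2^p s^(p/2) |f'|^p and the volume element s^(d/2-1), which
  together give the second weight. The constant from the volume of the ball is common to both sides
  and cancels.\<close>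

lemma radial_rayleigh:
  fixes f f' :: "real \<Rightarrow> real" and r R p c :: real
  defines "d \<equiv> real CARD('n::finite)"
  defines "al \<equiv> fundamental_eigenvalue (annulus r R) {x::real^'n. x \<bullet> x = c} p"
  assumes rR: "0 < r" "r < R" and p: "p > 0"
    and f: "\<And>k. C_k k f" "\<And>s. s \<ge> M \<Longrightarrow> f s = 0" "0 < e" "\<And>s. \<bar>s - c\<bar> < e \<Longrightarrow> f s = 0"
    and f': "\<And>s. s \<in> {r\<^sup>2..R\<^sup>2} \<Longrightarrow> (f has_real_derivative f' s) (at s)" "continuous_on {r\<^sup>2..R\<^sup>2} f'"
  shows "al * integral {r\<^sup>2..R\<^sup>2} (\<lambda>s. \<bar>f s\<bar> powr p * s powr (d / 2 - 1)) \<le>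
    integral {r\<^sup>2..R\<^sup>2} (\<lambda>s. \<bar>f' s\<bar> powr p * (2 powr p * s powr ((p + d) / 2 - 1)))"
proof -
  let ?A = "annulus r R :: (real^'n) set"
  define C where "C = unit_ball_vol d * (d / 2)"
  have C: "C > 0" by (simp add: C_def d_def)
  have DIM: "real DIM(real^'n) = d" by (simp add: d_def)
  have powr_cont: "continuous_on {r\<^sup>2..R\<^sup>2} (\<lambda>s. \<bar>g s\<bar> powr p)" if "continuous_on {r\<^sup>2..R\<^sup>2} g" for g :: "real \<Rightarrow> real"
    using that p by (intro continuous_on_powr' continuous_on_rabs continuous_on_const) auto
  have "al * (LINT x:?A|lborel. \<bar>f (x \<bullet> x)\<bar> powr p) \<le> (LINT x:?A|lborel. norm (grad (\<lambda>x. f (x \<bullet> x)) x) powr p)"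
    unfolding al_def by (intro rayleigh_quotient_le radial_test_function[OF f])
  also have "(LINT x:?A|lborel. \<bar>f (x \<bullet> x)\<bar> powr p) =
      C * integral {r\<^sup>2..R\<^sup>2} (\<lambda>s. \<bar>f s\<bar> powr p * s powr (d / 2 - 1))"
    using integral_radial_annulus[where 'a="real^'n", OF rR powr_cont[OF C_k_continuous_on[OF f(1)]]]
    unfolding DIM C_def .
  also have "(LINT x:?A|lborel. norm (grad (\<lambda>x. f (x \<bullet> x)) x) powr p) =
      (LINT x:?A|lborel. \<bar>f' (x \<bullet> x)\<bar> powr p * (2 powr p * (x \<bullet> x) powr (p / 2)))"
  proof (rule set_lebesgue_integral_cong)
    show "?A \<in> sets lborel" unfolding annulus_def by measurable
    show "\<forall>x. x \<in> ?A \<longrightarrow> norm (grad (\<lambda>x. f (x \<bullet> x)) x) powr p =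
        \<bar>f' (x \<bullet> x)\<bar> powr p * (2 powr p * (x \<bullet> x) powr (p / 2))"
    proof (intro allI impI)
      fix x :: "real^'n" assume "x \<in> ?A"
      then have "r < norm x" "norm x < R" by (auto simp: annulus_def)
      then have "x \<bullet> x \<in> {r\<^sup>2..R\<^sup>2}" using rR by (simp add: dot_square_norm)
      then have "grad (\<lambda>x. f (x \<bullet> x)) x = (2 * f' (x \<bullet> x)) *\<^sub>R x"
        by (intro grad_eqI GDERIV_radial f')
      moreover have "(x \<bullet> x) powr (p / 2) = norm x powr p"
        using \<open>r < norm x\<close> rR by (simp add: norm_eq_sqrt_inner powr_half_sqrt[symmetric] powr_powr)
      ultimately show "norm (grad (\<lambda>x. f (x \<bullet> x)) x) powr p =
          \<bar>f' (x \<bullet> x)\<bar> powr p * (2 powr p * (x \<bullet> x) powr (p / 2))"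
        by (simp add: powr_mult abs_mult mult_ac)
    qed
  qed
  also have "\<dots> = C * integral {r\<^sup>2..R\<^sup>2} (\<lambda>s. \<bar>f' s\<bar> powr p * (2 powr p * s powr (p / 2)) * s powr (d / 2 - 1))"
  proof -
    have "continuous_on {r\<^sup>2..R\<^sup>2} (\<lambda>s. \<bar>f' s\<bar> powr p * (2 powr p * s powr (p / 2)))"
      using rR by (intro continuous_on_mult powr_cont f' continuous_on_powr continuous_on_const continuous_on_id) auto
    from integral_radial_annulus[where 'a="real^'n", OF rR this]
    show ?thesis unfolding DIM C_def .
  qed
  also have "integral {r\<^sup>2..R\<^sup>2} (\<lambda>s. \<bar>f' s\<bar> powr p * (2 powr p * s powr (p / 2)) * s powr (d / 2 - 1)) =
      integral {r\<^sup>2..R\<^sup>2} (\<lambda>s. \<bar>f' s\<bar> powr p * (2 powr p * s powr ((p + d) / 2 - 1)))"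
  proof (rule integral_cong)
    fix s assume "s \<in> {r\<^sup>2..R\<^sup>2}"
    have "s powr (p / 2) * s powr (d / 2 - 1) = s powr ((p + d) / 2 - 1)"
      by (simp add: add_divide_distrib algebra_simps flip: powr_add)
    then show "\<bar>f' s\<bar> powr p * (2 powr p * s powr (p / 2)) * s powr (d / 2 - 1) =
        \<bar>f' s\<bar> powr p * (2 powr p * s powr ((p + d) / 2 - 1))"
      by (simp only: mult.assoc)
  qed
  finally show ?thesis using C by (simp add: mult.left_commute[of al])
qed

section \<open>Approximation by functions vanishing near the Dirichlet end\<close>

lemma powr_integral_tendsto:
  fixes f :: "nat \<Rightarrow> real \<Rightarrow> real"
  assumes "\<And>n. continuous_on {a..b} (f n)" "continuous_on {a..b} w"
    and B: "\<And>n s. s \<in> {a..b} \<Longrightarrow> \<bar>f n s\<bar> \<le> B"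
    and lim: "\<And>s. s \<in> {a<..<b} \<Longrightarrow> (\<lambda>n. f n s) \<longlonglongrightarrow> g s" and p: "p > 0"
  shows "(\<lambda>n. integral {a..b} (\<lambda>s. \<bar>f n s\<bar> powr p * w s)) \<longlonglongrightarrow>
    integral {a..b} (\<lambda>s. \<bar>g s\<bar> powr p * w s)"
  unfolding integral_open_interval_real
\<comment> \<open>Working on the open interval discards the Dirichlet end, where the cut-off
  derivatives used later stay 0 and need not converge to the given function.\<close>
proof (rule dominated_convergence(2))
  show "(\<lambda>s. \<bar>f n s\<bar> powr p * w s) integrable_on {a<..<b}" for n
    unfolding integrable_on_Icc_iff_Ioo[symmetric] using p
    by (intro integrable_continuous_real continuous_on_mult continuous_on_powr' continuous_on_rabs
        continuous_on_const assms) auto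
  show "(\<lambda>s. B powr p * \<bar>w s\<bar>) integrable_on {a<..<b}"
    unfolding integrable_on_Icc_iff_Ioo[symmetric]
    by (intro integrable_continuous_real continuous_on_mult continuous_on_rabs continuous_on_const assms)
  fix s assume s: "s \<in> {a<..<b}"
  show "norm (\<bar>f n s\<bar> powr p * w s) \<le> B powr p * \<bar>w s\<bar>" for n
    using B[of s n] s p by (auto simp: abs_mult intro!: mult_right_mono powr_mono2)
  show "(\<lambda>n. \<bar>f n s\<bar> powr p * w s) \<longlonglongrightarrow> \<bar>g s\<bar> powr p * w s"
    using p by (intro tendsto_mult tendsto_const tendsto_powr' tendsto_rabs lim[OF s]) auto
qed

lemma abs_le_integral_abs_derivative:
  fixes w v :: "real \<Rightarrow> real"
  assumes w: "\<And>s. s \<in> {a..b} \<Longrightarrow> (w has_real_derivative v s) (at s within {a..b})" "w c = 0"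
    and v: "continuous_on {a..b} v" and c: "c \<in> {a..b}" and s: "s \<in> {a..b}"
  shows "\<bar>w s\<bar> \<le> integral {a..b} (\<lambda>s. \<bar>v s\<bar>)"
proof -
  have *: "\<bar>w y - w x\<bar> \<le> integral {a..b} (\<lambda>s. \<bar>v s\<bar>)" if "x \<in> {a..b}" "y \<in> {a..b}" "x \<le> y" for x y
  proof -
    have sub: "{x..y} \<subseteq> {a..b}" using that by auto
    have "(v has_integral (w y - w x)) {x..y}"
      using sub that(3)
      by (intro fundamental_theorem_of_calculus)
        (auto simp: has_real_derivative_iff_has_vector_derivative[symmetric] intro!: DERIV_subset[OF w(1)])
    then have "\<bar>w y - w x\<bar> = norm (integral {x..y} v)" by (simp add: integral_unique)
    also have "\<dots> \<le> integral {x..y} (\<lambda>s. \<bar>v s\<bar>)"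
      using continuous_on_subset[OF v sub]
      by (intro integral_norm_bound_integral integrable_continuous_real continuous_on_rabs) auto
    also have "\<dots> \<le> integral {a..b} (\<lambda>s. \<bar>v s\<bar>)"
      using sub v continuous_on_subset[OF v sub]
      by (intro integral_subset_le integrable_continuous_real continuous_on_rabs) auto
    finally show ?thesis .
  qed
  show ?thesis
    using *[of c s] *[of s c] c s w(2) by (cases "c \<le> s") auto
qed

lemma continuous_on_Icc_abs_bound:
  fixes u :: "real \<Rightarrow> real"
  assumes "continuous_on {a..b} u"
  obtains M where "\<And>s. s \<in> {a..b} \<Longrightarrow> \<bar>u s\<bar> \<le> M"
proof -
  obtain M where "\<forall>x\<in>u ` {a..b}. norm x \<le> M"
    using compact_imp_bounded[OF compact_continuous_image[OF assms compact_Icc]]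
    by (auto simp: bounded_iff)
  then show ?thesis by (intro that[of M]) auto
qed

text \<open>The derivative is approximated instead of the function: once it vanishes near
  \<open>c\<close>, so does its antiderivative normalised at \<open>c\<close>. The approximants are
  Weierstrass polynomials multiplied by a cut-off, with a bound uniform in n.\<close>

lemma smooth_derivative_approximation:
  fixes u :: "real \<Rightarrow> real"
  assumes u: "continuous_on {a..b} u"
  obtains v :: "nat \<Rightarrow> real \<Rightarrow> real" and B e where "\<And>n k. C_k k (v n)" "\<And>n s. s \<in> {a..b} \<Longrightarrow> \<bar>v n s\<bar> \<le> B"
    "\<And>n. 0 < e n" "\<And>n s. \<bar>s - c\<bar> < e n \<Longrightarrow> v n s = 0"
    "\<And>s. s \<in> {a..b} \<Longrightarrow> s \<noteq> c \<Longrightarrow> (\<lambda>n. v n s) \<longlonglongrightarrow> u s"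
proof -
  obtain \<sigma> :: "real \<Rightarrow> real" where \<sigma>: "\<And>k. C_k k \<sigma>" "\<And>x. 0 \<le> \<sigma> x" "\<And>x. \<sigma> x \<le> 1"
    "\<And>x. x \<le> 1 \<Longrightarrow> \<sigma> x = 0" "\<And>x. x \<ge> 2 \<Longrightarrow> \<sigma> x = 1" using smooth_step_exists by blast
  define e where "e n = 1 / real (Suc n)" for n
  have e: "e n > 0" "e n \<le> 1" for n by (auto simp: e_def)
  have "\<exists>P. real_polynomial_function P \<and> (\<forall>s\<in>{a..b}. \<bar>u s - P s\<bar> < e n)" for n
    using Stone_Weierstrass_real_polynomial_function[OF compact_Icc u e(1)[of n]] by metis
  then obtain P where P: "\<And>n. real_polynomial_function (P n)" "\<And>n s. s \<in> {a..b} \<Longrightarrow> \<bar>u s - P n s\<bar> < e n"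
    by metis
  \<comment> \<open>\<open>e n\<close> is both the accuracy of the polynomial and the width of the
    cut-off. The squared distance keeps the cut-off smooth across \<open>c\<close>; its argument is
    at most 1 within distance \<open>e n\<close> and at least 4 beyond twice that distance.\<close>
  define v where "v n s = P n s * \<sigma> ((1 / e n)\<^sup>2 * ((s - c) * (s - c)))" for n s
  obtain Mu where Mu: "\<And>s. s \<in> {a..b} \<Longrightarrow> \<bar>u s\<bar> \<le> Mu"
    using continuous_on_Icc_abs_bound[OF u] by blast
  show ?thesis
  proof (rule that[of v "Mu + 1" e])
    show "C_k k (v n)" for k n
      unfolding v_def
      by (rule C_k_mult[OF C_k_real_polynomial_function[OF P(1)] C_k_compose_real[OF \<sigma>(1)]],
          rule C_k_cmult, rule C_k_mult; rule C_k_diff; simp)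
    show "\<bar>v n s\<bar> \<le> Mu + 1" if "s \<in> {a..b}" for n s
    proof -
      have "\<bar>v n s\<bar> \<le> \<bar>P n s\<bar> * 1"
        unfolding v_def abs_mult using \<sigma>(2,3) by (intro mult_left_mono) auto
      then show ?thesis using P(2)[OF that, of n] Mu[OF that] e(2)[of n] by linarith
    qed
    show "v n s = 0" if "\<bar>s - c\<bar> < e n" for n s
    proof -
      have "(1 / e n)\<^sup>2 * ((s - c) * (s - c)) = (\<bar>s - c\<bar> / e n)\<^sup>2"
        by (simp add: power_divide power2_eq_square)
      also have "\<dots> \<le> 1" using that e(1)[of n] by (intro power_le_one) auto
      finally show ?thesis by (simp add: v_def \<sigma>(4))
    qed
    show "(\<lambda>n. v n s) \<longlonglongrightarrow> u s" if s: "s \<in> {a..b}" "s \<noteq> c" for s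
    proof -
      have e0: "e \<longlonglongrightarrow> 0" unfolding e_def using LIMSEQ_Suc[OF lim_1_over_n] by simp
      have "(\<lambda>n. u s - P n s) \<longlonglongrightarrow> 0"
        using P(2)[OF s(1)] by (intro Lim_null_comparison[OF always_eventually e0]) (auto intro: less_imp_le)
      then have "(\<lambda>n. u s - (u s - P n s)) \<longlonglongrightarrow> u s - 0" by (intro tendsto_diff tendsto_const)
      then have Pu: "(\<lambda>n. P n s) \<longlonglongrightarrow> u s" by simp
      have "\<forall>\<^sub>F n in sequentially. e n < \<bar>s - c\<bar> / 2"
        using e0 s by (intro order_tendstoD) auto
      then have "\<forall>\<^sub>F n in sequentially. P n s = v n s"
      proof eventually_elim
        case (elim n)
        then have "2 \<le> \<bar>s - c\<bar> / e n" using e(1)[of n] by (simp add: field_simps)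
        then have "2\<^sup>2 \<le> (\<bar>s - c\<bar> / e n)\<^sup>2" by (intro power_mono) auto
        also have "\<dots> = (1 / e n)\<^sup>2 * ((s - c) * (s - c))"
          by (simp add: power_divide power2_eq_square)
        finally show ?case by (simp add: v_def \<sigma>(5))
      qed
      with Pu show ?thesis by (rule Lim_transform_eventually)
    qed
  qed (rule e)
qed

text \<open>Transfers the eigenvalue bound from smooth functions vanishing near the Dirichlet sphere
  to C^1 profiles that vanish only at \<open>c\<close>, by passing to the limit on both
  sides.\<close>

lemma annulus_hardy:
  fixes u h :: "real \<Rightarrow> real" and r R p c :: real
  defines "d \<equiv> real CARD('n::finite)"
  defines "al \<equiv> fundamental_eigenvalue (annulus r R) {x::real^'n. x \<bullet> x = c} p"
  assumes rR: "0 < r" "r < R" and p: "p > 0" and c: "c = r\<^sup>2 \<or> c = R\<^sup>2"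
    and u: "continuous_on {r\<^sup>2..R\<^sup>2} u"
    and h: "\<And>s. s \<in> {r\<^sup>2..R\<^sup>2} \<Longrightarrow> (h has_real_derivative u s) (at s within {r\<^sup>2..R\<^sup>2})" "h c = 0"
  shows "al * integral {r\<^sup>2..R\<^sup>2} (\<lambda>s. \<bar>h s\<bar> powr p * s powr (d / 2 - 1)) \<le>
    integral {r\<^sup>2..R\<^sup>2} (\<lambda>s. \<bar>u s\<bar> powr p * (2 powr p * s powr ((p + d) / 2 - 1)))"
proof -
  define a where "a = r\<^sup>2"
  define b where "b = R\<^sup>2"
  have ab: "0 < a" "a < b" using rR by (auto simp: a_def b_def power_strict_mono)
  have cab: "c \<in> {a..b}" "c \<notin> {a<..<b}" using c ab by (auto simp: a_def b_def)
  note u = u[folded a_def b_def] and h = h[folded a_def b_def]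
  obtain v B e where v: "\<And>n k. C_k k (v n)" "\<And>n s. s \<in> {a..b} \<Longrightarrow> \<bar>v n s\<bar> \<le> B"
    "\<And>n. 0 < e n" "\<And>n s. \<bar>s - c\<bar> < e n \<Longrightarrow> v n s = 0"
    "\<And>s. s \<in> {a..b} \<Longrightarrow> s \<noteq> c \<Longrightarrow> (\<lambda>n. v n s) \<longlonglongrightarrow> u s"
    using smooth_derivative_approximation[OF u, of c] by blast
  have v_cont: "continuous_on S (v n)" for S n by (rule C_k_continuous_on[OF v(1)])
  have "\<exists>F. (\<forall>s. (F has_real_derivative v n s) (at s)) \<and> F c = 0" for n
    using continuous_antiderivative[OF v_cont] by metis
  then obtain F where F: "\<And>n s. (F n has_real_derivative v n s) (at s)" "\<And>n. F n c = 0" by metis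
  have F_smooth: "C_k k (F n)" for k n by (rule C_k_Suc_D[OF C_k_Suc_realI[OF F(1) v(1)]])
  have F_cont: "continuous_on S (F n)" for S n by (rule C_k_continuous_on[OF F_smooth])
  have F_zero: "F n s = 0" if s: "\<bar>s - c\<bar> < e n" for n s
  proof -
    have D0: "(F n has_real_derivative 0) (at z)" if "\<bar>z - c\<bar> < e n" for z
      using F(1)[of n z] v(4)[OF that] by simp
    consider "s < c" | "s = c" | "c < s" by linarith
    then show ?thesis
    proof cases
      case 1
      then show ?thesis using DERIV_isconst_end[OF 1 F_cont] D0 s F(2)[of n] by auto
    next
      case 3
      then show ?thesis using DERIV_isconst_end[OF 3 F_cont] D0 s F(2)[of n] by auto
    qed (use F in simp)
  qed
  obtain \<sigma> :: "real \<Rightarrow> real" where \<sigma>: "\<And>k. C_k k \<sigma>" "\<And>x. 0 \<le> \<sigma> x" "\<And>x. \<sigma> x \<le> 1"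
    "\<And>x. x \<le> 1 \<Longrightarrow> \<sigma> x = 0" "\<And>x. x \<ge> 2 \<Longrightarrow> \<sigma> x = 1" using smooth_step_exists by blast
  \<comment> \<open>Equal to 1 up to b + 1 and 0 from b + 2 on: it gives compact support without
    changing values or derivatives on the interval.\<close>
  define \<kappa> where "\<kappa> s = 1 - \<sigma> (s - b)" for s
  have \<kappa>_smooth: "C_k k \<kappa>" for k
    unfolding \<kappa>_def by (rule C_k_diff[OF C_k_const C_k_compose_real[OF \<sigma>(1)]], rule C_k_diff; simp)
  define f where "f n s = \<kappa> s * F n s" for n s
  have f_eq: "f n s = F n s" if "s < b + 1" for n s
    using that \<sigma>(4)[of "s - b"] by (simp add: f_def \<kappa>_def)
  have ineq: "al * integral {a..b} (\<lambda>s. \<bar>F n s\<bar> powr p * s powr (d / 2 - 1)) \<le>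
      integral {a..b} (\<lambda>s. \<bar>v n s\<bar> powr p * (2 powr p * s powr ((p + d) / 2 - 1)))" for n
  proof -
    have "al * integral {r\<^sup>2..R\<^sup>2} (\<lambda>s. \<bar>f n s\<bar> powr p * s powr (d / 2 - 1)) \<le>
      integral {r\<^sup>2..R\<^sup>2} (\<lambda>s. \<bar>v n s\<bar> powr p * (2 powr p * s powr ((p + d) / 2 - 1)))"
      unfolding al_def d_def
    proof (rule radial_rayleigh[OF rR p])
      show "C_k k (f n)" for k unfolding f_def by (rule C_k_mult[OF \<kappa>_smooth F_smooth])
      show "f n s = 0" if "s \<ge> b + 2" for s
        using that \<sigma>(5)[of "s - b"] by (simp add: f_def \<kappa>_def)
      show "0 < e n" by (rule v)
      show "f n s = 0" if "\<bar>s - c\<bar> < e n" for s using F_zero[OF that] by (simp add: f_def)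
      show "(f n has_real_derivative v n s) (at s)" if "s \<in> {r\<^sup>2..R\<^sup>2}" for s
        using that
        by (intro has_field_derivative_transform_within_open[OF F(1)[of n s], of "{..<b + 1}"])
          (auto simp: f_eq b_def)
    qed (rule v_cont)
    also have "integral {r\<^sup>2..R\<^sup>2} (\<lambda>s. \<bar>f n s\<bar> powr p * s powr (d / 2 - 1)) =
        integral {r\<^sup>2..R\<^sup>2} (\<lambda>s. \<bar>F n s\<bar> powr p * s powr (d / 2 - 1))"
      by (intro integral_cong) (simp add: f_eq b_def)
    finally show ?thesis by (simp add: a_def b_def)
  qed
  have h_cont: "continuous_on {a..b} h" using h(1) by (intro DERIV_continuous_on) auto
  have pow_cont: "continuous_on {a..b} (\<lambda>s. s powr q)" for q
    using ab by (intro continuous_on_powr continuous_on_id continuous_on_const) auto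
  have v_lim: "(\<lambda>n. v n s) \<longlonglongrightarrow> u s" if "s \<in> {a<..<b}" for s
    using that cab by (intro v(5)) auto
  obtain Mu where Mu: "\<And>s. s \<in> {a..b} \<Longrightarrow> \<bar>u s\<bar> \<le> Mu"
    using continuous_on_Icc_abs_bound[OF u] by blast
  \<comment> \<open>Both antiderivatives vanish at \<open>c\<close>, so the L^1 distance of the
    derivatives bounds their distance uniformly.\<close>
  define \<delta> where "\<delta> n = integral {a..b} (\<lambda>s. \<bar>v n s - u s\<bar>)" for n
  have diff: "\<bar>F n s - h s\<bar> \<le> \<delta> n" if "s \<in> {a..b}" for n s
    unfolding \<delta>_def
  proof (rule abs_le_integral_abs_derivative[where w="\<lambda>s. F n s - h s" and c=c])
    show "((\<lambda>s. F n s - h s) has_real_derivative v n s - u s) (at s within {a..b})" if "s \<in> {a..b}" for s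
      by (intro DERIV_diff h(1) that has_field_derivative_at_within[OF F(1)])
    show "continuous_on {a..b} (\<lambda>s. v n s - u s)" by (intro continuous_on_diff v_cont u)
  qed (use F(2) h(2) cab that in auto)
  have \<delta>_lim: "\<delta> \<longlonglongrightarrow> 0"
  proof -
    have "(\<lambda>n. integral {a..b} (\<lambda>s. \<bar>v n s - u s\<bar> powr 1 * 1)) \<longlonglongrightarrow> integral {a..b} (\<lambda>s. \<bar>0::real\<bar> powr 1 * 1)"
    proof (rule powr_integral_tendsto)
      show "continuous_on {a..b} (\<lambda>s. v n s - u s)" for n by (intro continuous_on_diff v_cont u)
      show "\<bar>v n s - u s\<bar> \<le> B + Mu" if "s \<in> {a..b}" for n s
        using v(2)[OF that, of n] Mu[OF that] by linarith
      show "(\<lambda>n. v n s - u s) \<longlonglongrightarrow> 0" if "s \<in> {a<..<b}" for s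
        using LIM_zero[OF v_lim[OF that]] .
    qed auto
    then show ?thesis by (simp add: \<delta>_def[abs_def])
  qed
  obtain K where K: "\<And>n. \<bar>\<delta> n\<bar> \<le> K"
    using Bseq_def convergent_imp_Bseq[OF convergentI[OF \<delta>_lim]] by (auto simp: Bseq_def)
  obtain Mh where Mh: "\<And>s. s \<in> {a..b} \<Longrightarrow> \<bar>h s\<bar> \<le> Mh"
    using continuous_on_Icc_abs_bound[OF h_cont] by blast
  have lim1: "(\<lambda>n. integral {a..b} (\<lambda>s. \<bar>F n s\<bar> powr p * s powr (d / 2 - 1))) \<longlonglongrightarrow>
      integral {a..b} (\<lambda>s. \<bar>h s\<bar> powr p * s powr (d / 2 - 1))"
  proof (rule powr_integral_tendsto[OF F_cont pow_cont _ _ p])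
    show "\<bar>F n s\<bar> \<le> Mh + K" if "s \<in> {a..b}" for n s
      using diff[OF that, of n] K[of n] Mh[OF that] by linarith
    show "(\<lambda>n. F n s) \<longlonglongrightarrow> h s" if "s \<in> {a<..<b}" for s
    proof -
      have "(\<lambda>n. F n s - h s) \<longlonglongrightarrow> 0"
        using diff[of s] that by (intro Lim_null_comparison[OF always_eventually \<delta>_lim]) auto
      then show ?thesis by (rule LIM_zero_cancel)
    qed
  qed
  have lim2: "(\<lambda>n. integral {a..b} (\<lambda>s. \<bar>v n s\<bar> powr p * (2 powr p * s powr ((p + d) / 2 - 1)))) \<longlonglongrightarrow>
      integral {a..b} (\<lambda>s. \<bar>u s\<bar> powr p * (2 powr p * s powr ((p + d) / 2 - 1)))"
    by (rule powr_integral_tendsto[OF v_cont continuous_on_mult[OF continuous_on_const pow_cont] v(2) v_lim p])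
  show ?thesis
    using LIMSEQ_le[OF tendsto_mult[OF tendsto_const lim1] lim2] ineq by (auto simp: a_def b_def)
qed


section \<open>Green's formula and Young's inequality\<close>

text \<open>The derivative p |y|^(p-2) y of |y|^p. Written through positive and negative parts, it
  is visibly continuous at 0 for p > 1, whereas \<open>sgn\<close> is not.\<close>

definition powr_deriv :: "real \<Rightarrow> real \<Rightarrow> real" where
  "powr_deriv p y = p * (max y 0 powr (p - 1) - max (- y) 0 powr (p - 1))"

lemma powr_deriv_eq: "p > 1 \<Longrightarrow> powr_deriv p y = p * (\<bar>y\<bar> powr (p - 1) * sgn y)"
  by (auto simp: powr_deriv_def max_def sgn_if)

lemma continuous_on_powr_deriv: "p > 1 \<Longrightarrow> continuous_on UNIV (powr_deriv p)"
  unfolding powr_deriv_def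
  by (intro continuous_on_mult continuous_on_diff continuous_on_powr' continuous_on_max
      continuous_on_minus continuous_on_const continuous_on_id) auto

lemma abs_powr_has_derivative:
  assumes "p > 1"
  shows "((\<lambda>y. \<bar>y\<bar> powr p) has_real_derivative powr_deriv p y) (at y)"
proof -
  consider "y > 0" | "y = 0" | "y < 0" by linarith
  then show ?thesis
  proof cases
    case 1
    have "((\<lambda>y. y powr p) has_real_derivative powr_deriv p y) (at y)"
      using has_real_derivative_powr[OF 1, of p] 1 by (simp add: powr_deriv_def)
    then show ?thesis
      by (rule has_field_derivative_transform_within_open[where S="{0<..}"]) (use 1 in auto)
  next
    case 2
    have "(\<lambda>h. \<bar>h\<bar> powr p / h) \<midarrow>0\<rightarrow> 0"
    proof (rule Lim_null_comparison)
      have "norm (\<bar>h\<bar> powr p / h) = \<bar>h\<bar> powr (p - 1)" for h :: real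
        by (cases "h = 0") (simp_all add: powr_diff abs_mult)
      then show "\<forall>\<^sub>F h in at 0. norm (\<bar>h\<bar> powr p / h) \<le> \<bar>h\<bar> powr (p - 1)" by simp
      have "((\<lambda>h. \<bar>h\<bar> powr (p - 1)) \<longlongrightarrow> \<bar>0\<bar> powr (p - 1)) (at (0::real))"
        using assms by (intro tendsto_powr' tendsto_rabs tendsto_ident_at tendsto_const) auto
      then show "((\<lambda>h. \<bar>h\<bar> powr (p - 1)) \<longlongrightarrow> 0) (at (0::real))" by simp
    qed
    then show ?thesis using 2 by (simp add: DERIV_def powr_deriv_def)
  next
    case 3
    then have "((\<lambda>y. (- y) powr p) has_real_derivative p * (- y) powr (p - 1) * (- 1)) (at y)"
      by (intro DERIV_chain2[OF has_real_derivative_powr]) (auto intro!: derivative_eq_intros)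
    then have "((\<lambda>y. (- y) powr p) has_real_derivative powr_deriv p y) (at y)"
      using 3 by (simp add: powr_deriv_def)
    then show ?thesis
      by (rule has_field_derivative_transform_within_open[where S="{..<0}"]) (use 3 in auto)
  qed
qed

lemma C_k_1_abs_powr: "p > 1 \<Longrightarrow> C_k 1 (\<lambda>y::real. \<bar>y\<bar> powr p)"
  unfolding One_nat_def
  by (rule C_k_Suc_realI[OF abs_powr_has_derivative]) (simp_all add: continuous_on_powr_deriv)

section \<open>Gradient, divergence and integrability\<close>

lemma grad_eq_sum:
  fixes f :: "real^'n \<Rightarrow> real"
  assumes "f differentiable at x"
  shows "grad f x = (\<Sum>i\<in>UNIV. frechet_derivative f (at x) (axis i 1) *\<^sub>R axis i 1)"
    and "frechet_derivative f (at x) v = v \<bullet> grad f x"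
proof -
  let ?D = "frechet_derivative f (at x)"
  let ?G = "\<Sum>i\<in>UNIV. ?D (axis i 1) *\<^sub>R axis i 1"
  have D: "(f has_derivative ?D) (at x)" using assms frechet_derivative_works by blast
  have *: "?D v = v \<bullet> ?G" for v
  proof -
    have "?D v = ?D (\<Sum>i\<in>UNIV. v $ i *\<^sub>R axis i 1)"
      using basis_expansion[of v] by (simp add: scalar_mult_eq_scaleR)
    also have "\<dots> = (\<Sum>i\<in>UNIV. v $ i * ?D (axis i 1))"
      using has_derivative_linear[OF D] by (simp add: linear_sum linear_scale)
    also have "\<dots> = v \<bullet> ?G"
      by (simp add: inner_sum_right inner_axis mult.commute)
    finally show ?thesis .
  qed
  then have "?D = (\<lambda>v. v \<bullet> ?G)" by blast
  then have "GDERIV f x :> ?G" using D by (simp add: gderiv_def)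
  then show G: "grad f x = ?G" by (rule grad_eqI)
  show "?D v = v \<bullet> grad f x" unfolding G by (rule *)
qed

lemma continuous_on_grad:
  fixes f :: "real^'n \<Rightarrow> real"
  assumes "C_k (Suc 0) f"
  shows "continuous_on S (grad f)"
proof -
  have "continuous_on UNIV (\<lambda>x. frechet_derivative f (at x) v)" for v using assms by simp
  then have "continuous_on UNIV (\<lambda>x. \<Sum>i\<in>UNIV. frechet_derivative f (at x) (axis i 1) *\<^sub>R (axis i 1 :: real^'n))"
    by (rule continuous_on_sum[OF continuous_on_scaleR[OF _ continuous_on_const]])
  moreover have "grad f = (\<lambda>x. \<Sum>i\<in>UNIV. frechet_derivative f (at x) (axis i 1) *\<^sub>R axis i 1)"
    using assms grad_eq_sum(1) by (intro ext) auto
  ultimately show ?thesis by (metis continuous_on_subset subset_UNIV)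
qed

lemma divergence_scaleR_ident:
  fixes f :: "real^'n \<Rightarrow> real"
  assumes "GDERIV f x :> G"
  shows "divergence (\<lambda>x. f x *\<^sub>R x) x = real CARD('n) * f x + G \<bullet> x"
proof -
  have "((\<lambda>x. f x *\<^sub>R x) has_derivative (\<lambda>v. f x *\<^sub>R v + (v \<bullet> G) *\<^sub>R x)) (at x)"
    using assms unfolding gderiv_def by (intro has_derivative_scaleR has_derivative_ident)
  from frechet_derivative_at[OF this]
  have "frechet_derivative (\<lambda>x. f x *\<^sub>R x) (at x) = (\<lambda>v. f x *\<^sub>R v + (v \<bullet> G) *\<^sub>R x)" by simp
  then have "divergence (\<lambda>x. f x *\<^sub>R x) x = (\<Sum>i\<in>UNIV. f x + G $ i * x $ i)"
    by (simp add: divergence_def inner_axis' mult.commute)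
  then show ?thesis by (simp add: sum.distrib inner_vec_def)
qed

lemma set_integrable_continuous_bounded:
  fixes f :: "'a::euclidean_space \<Rightarrow> real"
  assumes "continuous_on UNIV f" "open S" "bounded S"
  shows "set_integrable lborel S f"
proof -
  have "set_integrable lborel (closure S) f"
    unfolding set_integrable_def using assms
    by (intro borel_integrable_compact continuous_on_subset[OF assms(1)]) (auto simp: compact_closure)
  then show ?thesis
    by (rule set_integrable_subset) (use assms closure_subset in auto)
qed

text \<open>Young's inequality for |z| and |w|^(p-1) |X|: with the conjugate exponent q = p / (p -
  1), the q-th power of the second is |w|^p |X|^q. Cauchy-Schwarz reduces the mixed term to this
  product. It is applied with w = \<zeta> and z its gradient.\<close>

lemma picone_pointwise:
  fixes z X :: "'a::real_inner" and p w :: real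
  assumes p: "p > 1"
  shows "\<bar>w\<bar> powr p * ((p - 1) * norm X powr (p / (p - 1))) + powr_deriv p w * (z \<bullet> X) + norm z powr p \<ge> 0"
proof -
  define q where "q = p / (p - 1)"
  have q: "q > 1" "1 / p + 1 / q = 1" using p by (auto simp: q_def field_simps)
  define B where "B = \<bar>w\<bar> powr (p - 1) * norm X"
  have "norm z * B \<le> norm z powr p / p + B powr q / q"
    using p q by (intro Youngs_inequality) (auto simp: B_def)
  then have "p * (norm z * B) \<le> p * (norm z powr p / p + B powr q / q)"
    using p by (intro mult_left_mono) auto
  also have "\<dots> = norm z powr p + (p - 1) * B powr q" using p by (simp add: q_def field_simps)
  also have "B powr q = \<bar>w\<bar> powr p * norm X powr q"
    using p by (simp add: B_def powr_mult powr_powr q_def)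
  finally have 1: "p * (norm z * B) \<le> norm z powr p + (p - 1) * (\<bar>w\<bar> powr p * norm X powr q)" .
  have "\<bar>powr_deriv p w * (z \<bullet> X)\<bar> \<le> (p * \<bar>w\<bar> powr (p - 1)) * (norm z * norm X)"
    unfolding abs_mult[of "powr_deriv p w"]
  proof (rule mult_mono)
    show "\<bar>powr_deriv p w\<bar> \<le> p * \<bar>w\<bar> powr (p - 1)"
      using p by (auto simp: powr_deriv_eq abs_mult sgn_if)
  qed (use p Cauchy_Schwarz_ineq2 in auto)
  also have "\<dots> = p * (norm z * B)" by (simp add: B_def)
  finally have "- (powr_deriv p w * (z \<bullet> X)) \<le> p * (norm z * B)" by linarith
  with 1 show ?thesis by (simp add: q_def algebra_simps)
qed

lemma eigenvalue_bound_by_radial_field: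
  fixes \<Omega> D N :: "(real^'n) set" and Q Q' :: "real \<Rightarrow> real" and p r R lam :: real
  defines "d \<equiv> real CARD('n)"
  assumes p: "p > 1" and r: "0 < r" and \<Omega>: "open \<Omega>" "bounded \<Omega>"
    and dec: "boundary_decomposition \<Omega> D N" and green: "green_formula \<Omega> D"
    and sub: "\<Omega> \<subseteq> {x. r < norm x \<and> norm x < R}"
    and Q: "\<And>s. (Q has_real_derivative Q' s) (at s)" "continuous_on UNIV Q'"
    and ric: "\<And>s. s \<in> {r\<^sup>2..R\<^sup>2} \<Longrightarrow>
      lam + (p - 1) * (sqrt s * \<bar>Q s\<bar>) powr (p / (p - 1)) \<le> d * Q s + 2 * s * Q' s"
    and sign: "AE x in surface_measure. x \<in> N \<longrightarrow> Q (x \<bullet> x) * (outward_normal \<Omega> x \<bullet> x) \<le> 0"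
    and \<zeta>: "\<zeta> \<in> test_functions D"
  shows "lam * (LINT x:\<Omega>|lborel. \<bar>\<zeta> x\<bar> powr p) \<le> (LINT x:\<Omega>|lborel. norm (grad \<zeta> x) powr p)"
proof -
  have \<zeta>_C: "C_k k \<zeta>" for k using \<zeta> by (auto simp: test_functions_def)
  have \<zeta>_D: "compact (support \<zeta>)" "support \<zeta> \<inter> D = {}" using \<zeta> by (auto simp: test_functions_def)
  have \<zeta>_diff: "\<zeta> differentiable at x" for x using \<zeta>_C[of 1] by simp
  define f where "f x = \<bar>\<zeta> x\<bar> powr p * Q (x \<bullet> x)" for x
  define F where "F x = f x *\<^sub>R x" for x
  have Q_C: "C_k 1 Q" unfolding One_nat_def by (rule C_k_Suc_realI[OF Q(1)]) (simp add: Q(2))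
  have f_C: "C_k 1 f" unfolding f_def
    by (rule C_k_mult[OF C_k_compose_real[OF C_k_1_abs_powr[OF p] \<zeta>_C] C_k_compose_real[OF Q_C C_k_inner_self]])
  have F_C: "C_k 1 F" unfolding F_def by (rule C_k_scaleR[OF f_C C_k_id])
  have supp: "support F \<subseteq> support \<zeta>"
    unfolding support_def F_def f_def by (rule closure_mono) auto
  have "compact (support F)"
    using compact_Int_closed[OF \<zeta>_D(1), of "support F"] supp
    by (simp add: support_def Int_absorb1)
  moreover have "support F \<inter> D = {}" using supp \<zeta>_D by blast
  ultimately have gf: "(LINT x:\<Omega>|lborel. divergence F x) =
      (LINT x:frontier \<Omega>|surface_measure. F x \<bullet> outward_normal \<Omega> x)"
    using green F_C unfolding green_formula_def by blast
  \<comment> \<open>On \<open>N\<close> the sign condition applies; the rest of the boundary is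
    \<open>D\<close>, where \<zeta> and hence the field vanish.\<close>
  have "0 \<le> (LINT x:frontier \<Omega>|surface_measure. - (F x \<bullet> outward_normal \<Omega> x))"
    unfolding set_lebesgue_integral_def
  proof (rule integral_nonneg_AE)
    show "AE x in surface_measure. 0 \<le> indicator (frontier \<Omega>) x *\<^sub>R (- (F x \<bullet> outward_normal \<Omega> x))"
      using sign
    proof eventually_elim
      case (elim x)
      show ?case
      proof (cases "x \<in> N")
        case True
        then have "\<bar>\<zeta> x\<bar> powr p * (Q (x \<bullet> x) * (outward_normal \<Omega> x \<bullet> x)) \<le> 0"
          by (intro mult_nonneg_nonpos[OF _ elim[rule_format]]) auto
        then show ?thesis by (simp add: F_def f_def indicator_def inner_commute mult.assoc)
      next
        case False
        have "F x = 0" if "x \<in> frontier \<Omega>"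
        proof -
          have "x \<in> D" using False that dec by (auto simp: boundary_decomposition_def)
          then have "x \<notin> support \<zeta>" using \<zeta>_D by blast
          then have "\<zeta> x = 0" using closure_subset[of "{x. \<zeta> x \<noteq> 0}"] by (auto simp: support_def)
          then show ?thesis by (simp add: F_def f_def)
        qed
        then show ?thesis by (simp add: indicator_def)
      qed
    qed
  qed
  then have bdry: "(LINT x:\<Omega>|lborel. divergence F x) \<le> 0"
    unfolding gf by (simp add: set_lebesgue_integral_def)
  \<comment> \<open>The Riccati inequality multiplied by |\<zeta>|^p replaces the bulk part of the
    divergence, and the pointwise Picone inequality absorbs the mixed term.\<close>
  have point: "lam * \<bar>\<zeta> x\<bar> powr p \<le> divergence F x + norm (grad \<zeta> x) powr p" if x: "x \<in> \<Omega>" for x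
  proof -
    have nx: "r < norm x" "norm x < R" using x sub by auto
    then have s: "x \<bullet> x \<in> {r\<^sup>2..R\<^sup>2}" using r by (simp add: dot_square_norm)
    define G where "G = (powr_deriv p (\<zeta> x) * Q (x \<bullet> x)) *\<^sub>R grad \<zeta> x + (\<bar>\<zeta> x\<bar> powr p * (2 * Q' (x \<bullet> x))) *\<^sub>R x"
    have D\<zeta>: "(\<zeta> has_derivative (\<lambda>v. v \<bullet> grad \<zeta> x)) (at x)"
    proof -
      have "frechet_derivative \<zeta> (at x) = (\<lambda>v. v \<bullet> grad \<zeta> x)"
        using grad_eq_sum(2)[OF \<zeta>_diff[of x]] by blast
      then show ?thesis using \<zeta>_diff[of x] by (simp add: frechet_derivative_works)
    qed
    have "((\<lambda>x. \<bar>\<zeta> x\<bar> powr p) has_derivative (\<lambda>v. powr_deriv p (\<zeta> x) * (v \<bullet> grad \<zeta> x))) (at x)"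
      using has_derivative_compose[OF D\<zeta> abs_powr_has_derivative[OF p, unfolded has_field_derivative_def]] .
    moreover have "((\<lambda>x. Q (x \<bullet> x)) has_derivative (\<lambda>v. v \<bullet> ((2 * Q' (x \<bullet> x)) *\<^sub>R x))) (at x)"
      using GDERIV_radial[OF Q(1)] by (simp add: gderiv_def)
    ultimately have "(f has_derivative (\<lambda>v. \<bar>\<zeta> x\<bar> powr p * (v \<bullet> ((2 * Q' (x \<bullet> x)) *\<^sub>R x)) +
        powr_deriv p (\<zeta> x) * (v \<bullet> grad \<zeta> x) * Q (x \<bullet> x))) (at x)"
      unfolding f_def by (rule has_derivative_mult)
    then have "GDERIV f x :> G"
      by (simp add: gderiv_def G_def inner_add_right mult_ac add_ac)
    then have "divergence F x = d * f x + G \<bullet> x"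
      unfolding F_def d_def by (rule divergence_scaleR_ident)
    then have div: "divergence F x = \<bar>\<zeta> x\<bar> powr p * (d * Q (x \<bullet> x) + 2 * (x \<bullet> x) * Q' (x \<bullet> x)) +
        powr_deriv p (\<zeta> x) * (grad \<zeta> x \<bullet> (Q (x \<bullet> x) *\<^sub>R x))"
      by (simp add: f_def G_def inner_add_left algebra_simps)
    have norm_X: "norm (Q (x \<bullet> x) *\<^sub>R x) = sqrt (x \<bullet> x) * \<bar>Q (x \<bullet> x)\<bar>"
      unfolding norm_scaleR norm_eq_sqrt_inner[of x] by (rule mult.commute)
    have "lam + (p - 1) * norm (Q (x \<bullet> x) *\<^sub>R x) powr (p / (p - 1)) \<le> d * Q (x \<bullet> x) + 2 * (x \<bullet> x) * Q' (x \<bullet> x)"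
      unfolding norm_X by (rule ric[OF s])
    then have "\<bar>\<zeta> x\<bar> powr p * (lam + (p - 1) * norm (Q (x \<bullet> x) *\<^sub>R x) powr (p / (p - 1))) \<le>
      \<bar>\<zeta> x\<bar> powr p * (d * Q (x \<bullet> x) + 2 * (x \<bullet> x) * Q' (x \<bullet> x))"
      by (intro mult_left_mono) auto
    then show ?thesis
      using picone_pointwise[OF p, of "\<zeta> x" "Q (x \<bullet> x) *\<^sub>R x" "grad \<zeta> x"] unfolding div
      by (simp only: ring_distribs mult.commute[of lam])
  qed
  have div_int: "set_integrable lborel \<Omega> (divergence F)"
    using F_C \<Omega> unfolding divergence_def One_nat_def
    by (intro set_integrable_continuous_bounded continuous_on_sum continuous_on_component) auto
  have grad_int: "set_integrable lborel \<Omega> (\<lambda>x. norm (grad \<zeta> x) powr p)"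
    using p by (intro set_integrable_continuous_bounded \<Omega> continuous_on_powr' continuous_on_norm
        continuous_on_grad \<zeta>_C continuous_on_const) auto
  have \<zeta>_int: "set_integrable lborel \<Omega> (\<lambda>x. lam * \<bar>\<zeta> x\<bar> powr p)"
    using p by (intro set_integrable_continuous_bounded \<Omega> continuous_on_mult continuous_on_powr'
        continuous_on_rabs C_k_continuous_on[OF \<zeta>_C] continuous_on_const) auto
  have "lam * (LINT x:\<Omega>|lborel. \<bar>\<zeta> x\<bar> powr p) = (LINT x:\<Omega>|lborel. lam * \<bar>\<zeta> x\<bar> powr p)"
    by simp
  also have "\<dots> \<le> (LINT x:\<Omega>|lborel. divergence F x + norm (grad \<zeta> x) powr p)"
    by (intro set_integral_mono \<zeta>_int set_integral_add(1) div_int grad_int point)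
  also have "\<dots> = (LINT x:\<Omega>|lborel. divergence F x) + (LINT x:\<Omega>|lborel. norm (grad \<zeta> x) powr p)"
    by (intro set_integral_add(2) div_int grad_int)
  finally show ?thesis using bdry by linarith
qed

text \<open>A real infimum is bounded below by \<open>al\<close> only over a nonempty set, so a test
  function must be exhibited. The bounds for all smaller \<open>lam\<close> then suffice, because
  every admissible denominator is positive.\<close>

lemma fundamental_eigenvalue_ge:
  fixes \<Omega> D :: "(real^'n) set"
  assumes \<Omega>: "open \<Omega>" "bounded \<Omega>" "\<Omega> \<noteq> {}" and D: "D \<inter> \<Omega> = {}" and p: "p > 0"
    and le: "\<And>lam \<zeta>. 0 < lam \<Longrightarrow> lam < al \<Longrightarrow> \<zeta> \<in> test_functions D \<Longrightarrow>
      lam * (LINT x:\<Omega>|lborel. \<bar>\<zeta> x\<bar> powr p) \<le> (LINT x:\<Omega>|lborel. norm (grad \<zeta> x) powr p)"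
  shows "al \<le> fundamental_eigenvalue \<Omega> D p"
  unfolding fundamental_eigenvalue_def
proof (rule cInf_greatest)
  obtain x0 where x0: "x0 \<in> \<Omega>" using \<Omega> by blast
  obtain e where e: "e > 0" "cball x0 e \<subseteq> \<Omega>" using open_contains_cball \<Omega>(1) x0 by blast
  \<comment> \<open>A bump supported in a closed ball inside \<Omega>, hence disjoint from
    \<open>D\<close>.\<close>
  define \<eta> where "\<eta> x = flat_exp 0 (e\<^sup>2 - (x - x0) \<bullet> (x - x0))" for x
  have "C_k k \<eta>" for k
  proof -
    have "C_k k (\<lambda>x. (x - x0) \<bullet> (x - x0))"
    proof -
      have "(\<lambda>x. (x - x0) \<bullet> (x - x0)) = (\<lambda>x. x \<bullet> x - (x \<bullet> (2 *\<^sub>R x0) - x0 \<bullet> x0))"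
        by (auto simp: inner_diff inner_commute)
      moreover have "C_k k (\<lambda>x. x \<bullet> x - (x \<bullet> (2 *\<^sub>R x0) - x0 \<bullet> x0))"
        by (rule C_k_diff[OF C_k_inner_self C_k_diff[OF C_k_bounded_linear[OF bounded_linear_inner_left] C_k_const]])
      ultimately show ?thesis by simp
    qed
    then show ?thesis unfolding \<eta>_def
      by (rule C_k_compose_real[OF C_k_flat_exp C_k_diff[OF C_k_const]])
  qed
  moreover have supp: "support \<eta> \<subseteq> cball x0 e"
    unfolding support_def
  proof (rule closure_minimal)
    show "{x. \<eta> x \<noteq> 0} \<subseteq> cball x0 e"
    proof
      fix x assume "x \<in> {x. \<eta> x \<noteq> 0}"
      then have "(norm (x - x0))\<^sup>2 < e\<^sup>2"
        by (auto simp: \<eta>_def flat_exp_def dot_square_norm split: if_splits)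
      then show "x \<in> cball x0 e"
        using e(1) power_less_imp_less_base[of "norm (x - x0)" 2 e] by (simp add: dist_norm norm_minus_commute)
    qed
  qed simp
  moreover have "compact (support \<eta>)"
    using compact_Int_closed[OF compact_cball, of "support \<eta>" x0 e] supp
    by (simp add: support_def Int_absorb1)
  moreover have "support \<eta> \<inter> D = {}" using supp e D by blast
  ultimately have "\<eta> \<in> test_functions D" by (simp add: test_functions_def)
  moreover have "\<eta> x0 \<noteq> 0" using e by (simp add: \<eta>_def flat_exp_def)
  ultimately show "{(LINT x:\<Omega>|lborel. norm (grad \<zeta> x) powr p) / (LINT x:\<Omega>|lborel. \<bar>\<zeta> x\<bar> powr p) |\<zeta>.
      \<zeta> \<in> test_functions D \<and> (\<exists>x\<in>\<Omega>. \<zeta> x \<noteq> 0)} \<noteq> {}"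
    using x0 by blast
next
  fix q assume "q \<in> {(LINT x:\<Omega>|lborel. norm (grad \<zeta> x) powr p) / (LINT x:\<Omega>|lborel. \<bar>\<zeta> x\<bar> powr p) |\<zeta>.
      \<zeta> \<in> test_functions D \<and> (\<exists>x\<in>\<Omega>. \<zeta> x \<noteq> 0)}"
  then obtain \<zeta> x0 where q: "q = (LINT x:\<Omega>|lborel. norm (grad \<zeta> x) powr p) / (LINT x:\<Omega>|lborel. \<bar>\<zeta> x\<bar> powr p)"
    and \<zeta>: "\<zeta> \<in> test_functions D" and x0: "x0 \<in> \<Omega>" "\<zeta> x0 \<noteq> 0" by blast
  have \<zeta>_cont: "continuous_on UNIV (\<lambda>x. \<bar>\<zeta> x\<bar> powr p)"
    using \<zeta> p C_k_continuous_on[of 0 \<zeta>]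
    by (intro continuous_on_powr' continuous_on_rabs continuous_on_const) (auto simp: test_functions_def)
  have pos: "(LINT x:\<Omega>|lborel. \<bar>\<zeta> x\<bar> powr p) > 0"
  proof -
    \<comment> \<open>By continuity |\<zeta>|^p exceeds half its value at \<open>x0\<close> on a
      small ball, which bounds the integral from below.\<close>
    define \<epsilon> where "\<epsilon> = \<bar>\<zeta> x0\<bar> powr p / 2"
    have \<epsilon>: "\<epsilon> > 0" using x0 by (simp add: \<epsilon>_def)
    have "open (\<Omega> \<inter> {x. \<epsilon> < \<bar>\<zeta> x\<bar> powr p})"
      by (intro open_Int \<Omega> open_Collect_less \<zeta>_cont continuous_on_const)
    moreover have "x0 \<in> \<Omega> \<inter> {x. \<epsilon> < \<bar>\<zeta> x\<bar> powr p}" using x0 by (simp add: \<epsilon>_def)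
    ultimately obtain e where e: "e > 0" "ball x0 e \<subseteq> \<Omega> \<inter> {x. \<epsilon> < \<bar>\<zeta> x\<bar> powr p}"
      using open_contains_ball by metis
    have "0 < \<epsilon> * measure lborel (ball x0 e)"
      using \<epsilon> content_ball_pos[OF e(1), of x0] by simp
    also have "\<dots> = (LINT x:ball x0 e|lborel. \<epsilon>)"
      using emeasure_lborel_ball_finite[of x0 e] by (simp add: set_lebesgue_integral_def)
    also have "\<dots> \<le> (LINT x:\<Omega>|lborel. \<bar>\<zeta> x\<bar> powr p)"
      unfolding set_lebesgue_integral_def
    proof (rule integral_mono)
      show "integrable lborel (\<lambda>x. indicator (ball x0 e) x *\<^sub>R \<epsilon>)"
        using set_integrable_continuous_bounded[of "\<lambda>x. \<epsilon>" "ball x0 e"]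
        unfolding set_integrable_def by simp
      show "integrable lborel (\<lambda>x. indicator \<Omega> x *\<^sub>R \<bar>\<zeta> x\<bar> powr p)"
        using set_integrable_continuous_bounded[OF \<zeta>_cont \<Omega>(1,2)] unfolding set_integrable_def .
      show "indicator (ball x0 e) x *\<^sub>R \<epsilon> \<le> indicator \<Omega> x *\<^sub>R \<bar>\<zeta> x\<bar> powr p" for x
        using subsetD[OF e(2), of x] by (auto simp: indicator_def intro: less_imp_le)
    qed
    finally show ?thesis .
  qed
  have grad0: "0 \<le> (LINT x:\<Omega>|lborel. norm (grad \<zeta> x) powr p)"
    unfolding set_lebesgue_integral_def by (intro integral_nonneg_AE) (auto simp: indicator_def)
  then have q0: "q \<ge> 0" unfolding q using pos by (intro divide_nonneg_pos)
  show "al \<le> q"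
  proof (rule ccontr)
    assume "\<not> al \<le> q"
    \<comment> \<open>The midpoint is a legitimate \<open>lam\<close>: it is positive since q \<ge>
      0 and q < al.\<close>
    then have "0 < (q + al) / 2" "(q + al) / 2 < al" "q < (q + al) / 2" using q0 by auto
    with le[OF this(1,2) \<zeta>] have "(q + al) / 2 \<le> q"
      unfolding q using pos by (simp add: pos_le_divide_eq)
    then show False using \<open>q < (q + al) / 2\<close> by simp
  qed
qed


section \<open>Comparison with the annulus\<close>

text \<open>The derivative is continued by its end values and integrated. Green's formula is stated
  for fields that are C^1 on the whole space, while the Riccati solution lives on the closed
  interval only.\<close>

lemma C1_extension:
  fixes f f' :: "real \<Rightarrow> real"
  assumes ab: "a \<le> b"
    and f: "\<And>s. s \<in> {a..b} \<Longrightarrow> (f has_real_derivative f' s) (at s within {a..b})" "continuous_on {a..b} f'"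
  obtains g g' where "\<And>s. (g has_real_derivative g' s) (at s)" "continuous_on UNIV g'"
    "\<And>s. s \<in> {a..b} \<Longrightarrow> g s = f s" "\<And>s. s \<in> {a..b} \<Longrightarrow> g' s = f' s"
proof -
  define g' where "g' s = f' (max a (min b s))" for s
  have g'_cont: "continuous_on UNIV g'"
    unfolding g'_def using ab
    by (intro continuous_on_compose2[OF f(2)] continuous_on_max continuous_on_min
        continuous_on_const continuous_on_id) auto
  have g'_eq: "g' s = f' s" if "s \<in> {a..b}" for s using that by (simp add: g'_def)
  obtain G where G: "\<And>s. (G has_real_derivative g' s) (at s)" "G a = 0"
    using continuous_antiderivative[OF g'_cont] by blast
  have "G s - f s = - f a" if "s \<in> {a..b}" for s
  proof -
    have "((\<lambda>s. G s - f s) has_real_derivative 0) (at s within {a..b})" if "s \<in> {a..b}" for s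
      using DERIV_diff[OF has_field_derivative_at_within[OF G(1)] f(1)[OF that]] g'_eq[OF that] by simp
    then obtain c where "\<And>s. s \<in> {a..b} \<Longrightarrow> G s - f s = c"
      using has_field_derivative_zero_constant[of "{a..b}" "\<lambda>s. G s - f s"] by auto
    from this[OF that] this[of a] show ?thesis using ab G(2) by simp
  qed
  then have "G s + f a = f s" if "s \<in> {a..b}" for s using that by (simp add: algebra_simps)
  moreover have "((\<lambda>s. G s + f a) has_real_derivative g' s) (at s)" for s
    using DERIV_add[OF G(1) DERIV_const, of "f a" s] by simp
  ultimately show ?thesis using g'_cont g'_eq by (intro that[of "\<lambda>s. G s + f a" g']) auto
qed

text \<open>The substitution \<open>y = 2 s\<^sup>d\<^sup>/\<^sup>2 Q\<close> turns the Riccati equation for \<open>y\<close> into the divergence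
  equation \<open>div X = lam + (p - 1) \<bar>X\<bar>\<^sup>p\<^sup>'\<close> for \<open>X x = Q(x \<bullet> x) x\<close>, where \<open>s = x \<bullet> x\<close>.\<close>

lemma radial_field_of_riccati:
  fixes y y' :: "real \<Rightarrow> real" and a b d p lam :: real
  assumes ab: "0 < a" "a < b" and p: "p > 1"
    and y: "\<And>s. s \<in> {a..b} \<Longrightarrow> (y has_real_derivative y' s) (at s within {a..b})" "continuous_on {a..b} y'"
    and ric: "\<And>s. s \<in> {a..b} \<Longrightarrow> y' s = lam * s powr (d / 2 - 1) + (p - 1) *
      ((2 powr p * s powr ((p + d) / 2 - 1)) * (\<bar>y s\<bar> / (2 powr p * s powr ((p + d) / 2 - 1))) powr (p / (p - 1)))"
  obtains Q Q' where "\<And>s. (Q has_real_derivative Q' s) (at s)" "continuous_on UNIV Q'"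
    "\<And>s. s \<in> {a..b} \<Longrightarrow> Q s = y s / (2 * s powr (d / 2))"
    "\<And>s. s \<in> {a..b} \<Longrightarrow> d * Q s + 2 * s * Q' s = lam + (p - 1) * (sqrt s * \<bar>Q s\<bar>) powr (p / (p - 1))"
proof -
  define q where "q s = y s / (2 * s powr (d / 2))" for s
  \<comment> \<open>The derivative of q in solved form: it makes d q + 2 s q' equal to y' /
    s^(d/2-1).\<close>
  define q' where "q' s = (y' s / s powr (d / 2 - 1) - d * q s) / (2 * s)" for s
  have pos: "s > 0" if "s \<in> {a..b}" for s using that ab by auto
  have shift: "s powr (d / 2) = s * s powr (d / 2 - 1)" if "s > 0" for s
    using powr_mult_base[of s "d / 2 - 1"] that by simp
  have q: "(q has_real_derivative q' s) (at s within {a..b})" if s: "s \<in> {a..b}" for s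
  proof -
    let ?P = "s powr (d / 2 - 1)"
    have "(q has_real_derivative (y' s * (2 * s powr (d / 2)) - y s * (2 * (d / 2 * ?P))) /
        ((2 * s powr (d / 2)) * (2 * s powr (d / 2)))) (at s within {a..b})"
      unfolding q_def[abs_def] using pos[OF s]
      by (intro DERIV_divide y(1) s DERIV_cmult has_field_derivative_at_within[OF has_real_derivative_powr]) auto
    also have "(y' s * (2 * s powr (d / 2)) - y s * (2 * (d / 2 * ?P))) /
        ((2 * s powr (d / 2)) * (2 * s powr (d / 2))) = q' s"
    proof -
      have "?P > 0" using pos[OF s] by simp
      then show ?thesis
        unfolding q'_def q_def shift[OF pos[OF s]] using pos[OF s] by (simp add: field_simps)
    qed
    finally show ?thesis .
  qed
  have q_cont: "continuous_on {a..b} q" using q by (intro DERIV_continuous_on) auto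
  have "continuous_on {a..b} q'"
    unfolding q'_def using pos ab
    by (intro continuous_on_divide continuous_on_diff continuous_on_mult continuous_on_const y(2) q_cont
        continuous_on_powr continuous_on_id) force+
  with q ab obtain Q Q' where Q: "\<And>s. (Q has_real_derivative Q' s) (at s)" "continuous_on UNIV Q'"
    "\<And>s. s \<in> {a..b} \<Longrightarrow> Q s = q s" "\<And>s. s \<in> {a..b} \<Longrightarrow> Q' s = q' s"
    using C1_extension[of a b q q'] by (metis less_imp_le)
  show ?thesis
  proof (rule that[of Q Q', OF Q(1,2)])
    fix s assume s: "s \<in> {a..b}"
    show "Q s = y s / (2 * s powr (d / 2))" using Q(3)[OF s] by (simp add: q_def)
    have s0: "s > 0" by (rule pos[OF s])
    let ?m0 = "s powr (d / 2 - 1)" and ?m1 = "2 powr p * s powr ((p + d) / 2 - 1)" and ?r = "p / (p - 1)"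
    have pos': "?m0 > 0" "?m1 > 0" using s0 by auto
    have "d * Q s + 2 * s * Q' s = y' s / ?m0"
      using s0 by (simp add: Q(3,4)[OF s] q'_def)
    also have "\<dots> = lam + (p - 1) * (?m1 / ?m0 * (\<bar>y s\<bar> / ?m1) powr ?r)"
      using pos' by (simp add: ric[OF s] add_divide_distrib)
    also have "?m1 / ?m0 * (\<bar>y s\<bar> / ?m1) powr ?r = (sqrt s * \<bar>Q s\<bar>) powr ?r"
    proof -
      \<comment> \<open>The ratio of the weights is (2 sqrt s)^p, the p-th power of the norm of the
        gradient of |x|^2.\<close>
      have m1: "?m1 = (2 * sqrt s) powr p * ?m0"
        using s0 by (simp add: powr_mult powr_half_sqrt[symmetric] powr_powr add_divide_distrib
            powr_add[symmetric] algebra_simps)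
      have abs_y: "\<bar>y s\<bar> = (2 * sqrt s) * ?m0 * (sqrt s * \<bar>Q s\<bar>)"
      proof -
        have "(2 * sqrt s) * ?m0 * (sqrt s * \<bar>Q s\<bar>) = 2 * (sqrt s * sqrt s) * ?m0 * \<bar>Q s\<bar>"
          by (simp only: mult_ac)
        also have "\<dots> = 2 * s powr (d / 2) * \<bar>Q s\<bar>" using s0 shift[OF s0] by simp
        also have "\<dots> = \<bar>y s\<bar>" using s0 by (simp add: Q(3)[OF s] q_def abs_mult)
        finally show ?thesis ..
      qed
      have "\<bar>y s\<bar> / ?m1 = (2 * sqrt s) powr (1 - p) * (sqrt s * \<bar>Q s\<bar>)"
        unfolding abs_y m1 using s0 pos' by (simp add: powr_diff)
      then have "(\<bar>y s\<bar> / ?m1) powr ?r = ((2 * sqrt s) powr (1 - p)) powr ?r * (sqrt s * \<bar>Q s\<bar>) powr ?r"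
        using s0 by (simp add: powr_mult)
      \<comment> \<open>The exponents multiply to (1 - p) p / (p - 1) = -p, which cancels the ratio
        of the weights.\<close>
      also have "((2 * sqrt s) powr (1 - p)) powr ?r = (2 * sqrt s) powr (- p)"
        using p unfolding powr_powr by (intro arg_cong2[where f="(powr)"]) (auto simp: field_simps)
      also have "\<dots> = 1 / (?m1 / ?m0)"
      proof -
        have "?m1 / ?m0 = (2 * sqrt s) powr p" unfolding m1 using pos'(1) by simp
        then show ?thesis by (simp only: powr_minus divide_inverse mult_1)
      qed
      finally have e: "(\<bar>y s\<bar> / ?m1) powr ?r = 1 / (?m1 / ?m0) * (sqrt s * \<bar>Q s\<bar>) powr ?r" .
      have cancel: "X * (1 / X * Z) = Z" if "0 < X" for X Z :: real using that by simp
      show ?thesis unfolding e by (rule cancel[OF divide_pos_pos[OF pos'(2,1)]])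
    qed
    finally show "d * Q s + 2 * s * Q' s = lam + (p - 1) * (sqrt s * \<bar>Q s\<bar>) powr ?r" .
  qed
qed

text \<open>\<open>c\<close> is the squared radius of the Dirichlet sphere. The Riccati solution is
  nonnegative when the Neumann end lies on the left; in the other case reflection reverses its sign,
  and with it the direction of the field.\<close>

lemma radial_field_exists:
  fixes r R p lam c :: real
  defines "d \<equiv> real CARD('n::finite)"
  assumes rR: "0 < r" "r < R" and p: "p > 1" and c: "c = r\<^sup>2 \<or> c = R\<^sup>2"
    and lam: "0 < lam" "lam < fundamental_eigenvalue (annulus r R) {x::real^'n. x \<bullet> x = c} p"
  obtains Q Q' where "\<And>s. (Q has_real_derivative Q' s) (at s)" "continuous_on UNIV Q'"
    "\<And>s. s \<in> {r\<^sup>2..R\<^sup>2} \<Longrightarrow> d * Q s + 2 * s * Q' s = lam + (p - 1) * (sqrt s * \<bar>Q s\<bar>) powr (p / (p - 1))"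
    "\<And>s. s \<in> {r\<^sup>2..R\<^sup>2} \<Longrightarrow> (if c = R\<^sup>2 then 0 \<le> Q s else Q s \<le> 0)"
proof -
  define a where "a = r\<^sup>2"
  define b where "b = R\<^sup>2"
  define al where "al = fundamental_eigenvalue (annulus r R) {x::real^'n. x \<bullet> x = c} p"
  have ab: "0 < a" "a < b" using rR by (auto simp: a_def b_def power_strict_mono)
  define m0 where "m0 s = s powr (d / 2 - 1)" for s
  define m1 where "m1 s = 2 powr p * s powr ((p + d) / 2 - 1)" for s
  have m_cont: "continuous_on {a..b} m0" "continuous_on {a..b} m1"
    unfolding m0_def m1_def using ab
    by (intro continuous_on_mult continuous_on_powr continuous_on_const continuous_on_id; auto)+
  have m_pos: "m0 s > 0" "m1 s > 0" if "s \<in> {a..b}" for s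
    using that ab by (auto simp: m0_def m1_def)
  have hardy: "al * integral {a..b} (\<lambda>s. \<bar>h s\<bar> powr p * m0 s) \<le> integral {a..b} (\<lambda>s. \<bar>u s\<bar> powr p * m1 s)"
    if "continuous_on {a..b} u" "\<And>s. s \<in> {a..b} \<Longrightarrow> (h has_real_derivative u s) (at s within {a..b})" "h c = 0"
    for h u
    using annulus_hardy[where 'n='n, OF rR, of p c u h] that p c
    unfolding al_def m0_def m1_def a_def b_def d_def by simp
  obtain y y' where y: "\<And>s. s \<in> {a..b} \<Longrightarrow> (y has_real_derivative y' s) (at s within {a..b})"
    "continuous_on {a..b} y'" "\<And>s. s \<in> {a..b} \<Longrightarrow> (if c = b then 0 \<le> y s else y s \<le> 0)"
    "\<And>s. s \<in> {a..b} \<Longrightarrow> y' s = lam * m0 s + (p - 1) * (m1 s * (\<bar>y s\<bar> / m1 s) powr (p / (p - 1)))"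
  proof (cases "c = b")
    case True
    interpret weighted_hardy m0 m1 p lam a b al
      using p ab lam m_cont m_pos hardy True by unfold_locales (auto simp: al_def)
    obtain y y' where y: "\<And>s. s \<in> {a..b} \<Longrightarrow> (y has_real_derivative y' s) (at s within {a..b})"
      "continuous_on {a..b} y'" "\<And>s. s \<in> {a..b} \<Longrightarrow> 0 \<le> y s"
      "\<And>s. s \<in> {a..b} \<Longrightarrow> y' s = lam * m0 s + (p - 1) * (m1 s * (y s / m1 s) powr (p / (p - 1)))"
      using riccati_solution by blast
    show ?thesis by (rule that[of y y']) (use y True in auto)
  next
    case False
    then have ca: "c = a" using c by (auto simp: a_def b_def)
    have refl: "uminus ` {a..b} = {-b..-a}" "uminus ` {-b..-a} = {a..b}" by auto
    have refl_deriv: "((\<lambda>s. g (- s)) has_real_derivative - (g' (- s))) (at s within S)"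
      if "(g has_real_derivative g' (- s)) (at (- s) within uminus ` S)" for g g' :: "real \<Rightarrow> real" and s S
    proof -
      have "(uminus has_real_derivative - 1) (at s within S)"
        using DERIV_minus[OF DERIV_ident, of s S] by simp
      from DERIV_image_chain[OF that this] show ?thesis by (simp add: o_def)
    qed
    have refl_int: "integral {-b..-a} (\<lambda>s. g s) = integral {a..b} (\<lambda>s. g (- s))" for g :: "real \<Rightarrow> real"
      using Henstock_Kurzweil_Integration.integral_reflect_real[of b a "\<lambda>s. g (- s)"] by simp
    have refl_cont: "continuous_on {-b..-a} (\<lambda>s. g (- s))" if "continuous_on {a..b} g" for g :: "real \<Rightarrow> real"
      using that by (intro continuous_on_compose2[OF that] continuous_on_minus continuous_on_id) auto
    \<comment> \<open>The reflection s to -s moves the Dirichlet end from \<open>a\<close> to the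
      right end \<open>- a\<close>, as the locale demands.\<close>
    interpret weighted_hardy "\<lambda>s. m0 (- s)" "\<lambda>s. m1 (- s)" p lam "- b" "- a" al
    proof unfold_locales
      fix u h :: "real \<Rightarrow> real"
      assume u: "continuous_on {-b..-a} u" and h: "\<And>s. s \<in> {-b..-a} \<Longrightarrow> (h has_real_derivative u s) (at s within {-b..-a})"
        and h0: "h (- a) = 0"
      have "al * integral {a..b} (\<lambda>s. \<bar>h (- s)\<bar> powr p * m0 s) \<le> integral {a..b} (\<lambda>s. \<bar>- u (- s)\<bar> powr p * m1 s)"
      proof (rule hardy)
        show "continuous_on {a..b} (\<lambda>s. - u (- s))"
          by (intro continuous_on_minus continuous_on_compose2[OF u] continuous_on_id) auto
        show "((\<lambda>s. h (- s)) has_real_derivative - u (- s)) (at s within {a..b})" if "s \<in> {a..b}" for s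
          using refl_deriv[of h u s "{a..b}"] h[of "- s"] that by (simp add: refl)
      qed (simp add: ca h0)
      then show "al * integral {-b..-a} (\<lambda>s. \<bar>h s\<bar> powr p * m0 (- s)) \<le> integral {-b..-a} (\<lambda>s. \<bar>u s\<bar> powr p * m1 (- s))"
        by (simp add: refl_int)
    qed (use p ab lam m_pos in \<open>auto simp: al_def intro!: refl_cont m_cont\<close>)
    obtain y y' where y: "\<And>s. s \<in> {-b..-a} \<Longrightarrow> (y has_real_derivative y' s) (at s within {-b..-a})"
      "continuous_on {-b..-a} y'" "\<And>s. s \<in> {-b..-a} \<Longrightarrow> 0 \<le> y s"
      "\<And>s. s \<in> {-b..-a} \<Longrightarrow> y' s = lam * m0 (- s) + (p - 1) * (m1 (- s) * (y s / m1 (- s)) powr (p / (p - 1)))"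
      using riccati_solution by blast
    show ?thesis
    \<comment> \<open>The odd reflection keeps the sign of the derivative, so the equation survives
      with |y| in place of y.\<close>
    proof (rule that[of "\<lambda>s. - y (- s)" "\<lambda>s. y' (- s)"])
      show "((\<lambda>s. - y (- s)) has_real_derivative y' (- s)) (at s within {a..b})" if "s \<in> {a..b}" for s
        using DERIV_minus[OF refl_deriv[of y y' s "{a..b}"]] y(1)[of "- s"] that by (simp add: refl)
      show "continuous_on {a..b} (\<lambda>s. y' (- s))"
        by (intro continuous_on_compose2[OF y(2)] continuous_on_minus continuous_on_id) auto
      show "if c = b then 0 \<le> - y (- s) else - y (- s) \<le> 0" if "s \<in> {a..b}" for s
        using y(3)[of "- s"] that False by auto
      show "y' (- s) = lam * m0 s + (p - 1) * (m1 s * (\<bar>- y (- s)\<bar> / m1 s) powr (p / (p - 1)))"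
        if "s \<in> {a..b}" for s
        using y(3,4)[of "- s"] that by simp
    qed
  qed
  obtain Q Q' where Q: "\<And>s. (Q has_real_derivative Q' s) (at s)" "continuous_on UNIV Q'"
    "\<And>s. s \<in> {a..b} \<Longrightarrow> Q s = y s / (2 * s powr (d / 2))"
    "\<And>s. s \<in> {a..b} \<Longrightarrow> d * Q s + 2 * s * Q' s = lam + (p - 1) * (sqrt s * \<bar>Q s\<bar>) powr (p / (p - 1))"
    using radial_field_of_riccati[OF ab p y(1,2) y(4)[unfolded m0_def m1_def]] by blast
  show ?thesis
  proof (rule that[of Q Q', OF Q(1,2)])
    fix s assume "s \<in> {r\<^sup>2..R\<^sup>2}"
    then have s: "s \<in> {a..b}" by (simp add: a_def b_def)
    show "d * Q s + 2 * s * Q' s = lam + (p - 1) * (sqrt s * \<bar>Q s\<bar>) powr (p / (p - 1))"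
      by (rule Q(4)[OF s])
    show "if c = R\<^sup>2 then 0 \<le> Q s else Q s \<le> 0"
      using y(3)[OF s] unfolding Q(3)[OF s] b_def[symmetric]
      by (auto simp: divide_nonneg_nonneg intro: divide_nonpos_nonneg split: if_splits)
  qed
qed

text \<open>Both cases at once: the sign of Q given by the choice of \<open>c\<close> is opposite to
  that of the normal component, so the flux through \<open>N\<close> is nonpositive.\<close>

lemma eigenvalue_ge_annulus:
  fixes \<Omega> D N :: "(real^'n) set" and p r R c :: real
  assumes p: "p > 1" and rR: "0 < r" "r < R" and c: "c = r\<^sup>2 \<or> c = R\<^sup>2"
    and \<Omega>: "bounded_domain \<Omega>" and dec: "boundary_decomposition \<Omega> D N" and green: "green_formula \<Omega> D"
    and sub: "\<Omega> \<subseteq> {x. r < norm x \<and> norm x < R}"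
    and sign: "AE x in surface_measure. x \<in> N \<longrightarrow>
      (if c = R\<^sup>2 then outward_normal \<Omega> x \<bullet> x \<le> 0 else outward_normal \<Omega> x \<bullet> x \<ge> 0)"
  shows "fundamental_eigenvalue (annulus r R) {x::real^'n. x \<bullet> x = c} p \<le> fundamental_eigenvalue \<Omega> D p"
proof -
  have \<Omega>': "open \<Omega>" "bounded \<Omega>" "\<Omega> \<noteq> {}" using \<Omega> by (auto simp: bounded_domain_def)
  have front: "D \<subseteq> frontier \<Omega>" "N \<subseteq> frontier \<Omega>" using dec by (auto simp: boundary_decomposition_def)
  \<comment> \<open>Boundary points may lie on the two spheres themselves; the sign of Q is known on
    the closed interval, so these are included.\<close>
  have N: "x \<bullet> x \<in> {r\<^sup>2..R\<^sup>2}" if "x \<in> N" for x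
  proof -
    have "closed {x::real^'n. r \<le> norm x \<and> norm x \<le> R}"
      by (intro closed_Collect_conj closed_Collect_le continuous_on_norm continuous_on_id continuous_on_const)
    then have "closure \<Omega> \<subseteq> {x. r \<le> norm x \<and> norm x \<le> R}"
      using sub by (intro closure_minimal) auto
    then have "r \<le> norm x" "norm x \<le> R" using that front by (auto simp: frontier_def)
    then show ?thesis using rR by (simp add: dot_square_norm)
  qed
  show ?thesis
  proof (rule fundamental_eigenvalue_ge[OF \<Omega>'])
    show "D \<inter> \<Omega> = {}" using front \<Omega>'(1) by (auto simp: frontier_def interior_open)
    show "p > 0" using p by simp
    fix lam :: real and \<zeta> :: "real^'n \<Rightarrow> real"
    assume lam: "0 < lam" "lam < fundamental_eigenvalue (annulus r R) {x::real^'n. x \<bullet> x = c} p"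
      and \<zeta>: "\<zeta> \<in> test_functions D"
    obtain Q Q' where Q: "\<And>s. (Q has_real_derivative Q' s) (at s)" "continuous_on UNIV Q'"
      "\<And>s. s \<in> {r\<^sup>2..R\<^sup>2} \<Longrightarrow> real CARD('n) * Q s + 2 * s * Q' s =
        lam + (p - 1) * (sqrt s * \<bar>Q s\<bar>) powr (p / (p - 1))"
      "\<And>s. s \<in> {r\<^sup>2..R\<^sup>2} \<Longrightarrow> (if c = R\<^sup>2 then 0 \<le> Q s else Q s \<le> 0)"
      using radial_field_exists[where 'n='n, OF rR p c lam] by blast
    show "lam * (LINT x:\<Omega>|lborel. \<bar>\<zeta> x\<bar> powr p) \<le> (LINT x:\<Omega>|lborel. norm (grad \<zeta> x) powr p)"
    proof (rule eigenvalue_bound_by_radial_field[OF p rR(1) \<Omega>'(1,2) dec green sub Q(1,2) _ _ \<zeta>])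
      show "AE x in surface_measure. x \<in> N \<longrightarrow> Q (x \<bullet> x) * (outward_normal \<Omega> x \<bullet> x) \<le> 0"
        using sign
      proof eventually_elim
        case (elim x)
        show ?case
        proof
          assume x: "x \<in> N"
          show "Q (x \<bullet> x) * (outward_normal \<Omega> x \<bullet> x) \<le> 0"
            using elim[rule_format, OF x] Q(4)[OF N[OF x]]
            by (auto simp: mult_le_0_iff split: if_splits)
        qed
      qed
    qed (simp add: Q(3))
  qed
qed

theorem mainTheorem6:
  fixes \<Omega> D N :: "(real^'n) set" and p r R :: real
  assumes "p > 1"
    and "0 < r" and "r < R"
    and "bounded_domain \<Omega>"
    and "regular_domain \<Omega>"
    and "boundary_decomposition \<Omega> D N"
    and "green_formula \<Omega> D"
    and "0 \<notin> closure \<Omega>"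
    and "starlike_wrt_origin N"
    and "\<Omega> \<subseteq> {x. r < norm x \<and> norm x < R}"
  shows "(interior_away_from_origin \<Omega> N \<longrightarrow>
            fundamental_eigenvalue \<Omega> D p \<ge> alpha_annulus TYPE('n) r R p) \<and>
         (exterior_away_from_origin \<Omega> N \<longrightarrow>
            fundamental_eigenvalue \<Omega> D p \<ge> beta_annulus TYPE('n) r R p)"
proof -
  have sphere: "{x::real^'n. norm x = t} = {x. x \<bullet> x = t\<^sup>2}" if "t > 0" for t
    using that by (auto simp: dot_square_norm)
  \<comment> \<open>Decides the condition \<open>c = R\<^sup>2\<close> in the sign hypothesis: true
    for \<open>\<alpha>\<close>-type Dirichlet data on the outer sphere, false for the inner
    one.\<close>
  have "r\<^sup>2 \<noteq> R\<^sup>2" using assms by simp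
  note ge = eigenvalue_ge_annulus[OF assms(1-3) _ assms(4,6,7,10)]
  show ?thesis
    using ge[of "R\<^sup>2"] ge[of "r\<^sup>2"] \<open>r\<^sup>2 \<noteq> R\<^sup>2\<close> assms(2,3)
    by (simp add: interior_away_from_origin_def exterior_away_from_origin_def
        alpha_annulus_def beta_annulus_def sphere)
qed

end
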